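(* Let $C_{70}$ be the genus-$2$ curve over $\mathbb{Q}$ given by \[ y^2 + (2 x^3 - 3 x^2 - 41 x + 110)\, y = x^3 - 51 x^2 + 425 x + 179 . \] Then the Jacobian of $C_{70}$ has a $\mathbb{Q}$-rational torsion point of order exactly $70$.
   Context: A genus-$2$ curve given by an affine equation $y^2 + h(x) y = f(x)$, with $\deg h \le 3$ and $\deg f\le 6$, means the smooth projective geometrically irreducible curve over $\mathbb{Q}$ with that affine model. Its Jacobian is the associated principally polarized abelian surface over $\mathbb{Q}$, and "rational" means defined over $\mathbb{Q}$. *)

theory Defs
  imports
    "HOL-Algebra.Algebraic_Closure_Type"
    "HOL-Algebra.Free_Abelian_Groups"
    "HOL-Algebra.Multiplicative_Group"
    "HOL-Computational_Algebra.Fraction_Field"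
    "HOL-Computational_Algebra.Polynomial_Factorial"
begin

section \<open>Places, divisors and degree-zero divisor classes\<close>

text \<open>
  Let \<open>F\<close> be a field of algebraic functions of one variable over an algebraically closed
  subfield \<open>k\<close>. The points of the smooth projective curve with function field \<open>F\<close> are the places
  of \<open>F / k\<close>, given here by their normalised discrete valuations \<open>v : F\<^sup>* \<rightarrow> \<int>\<close>, the order
  of vanishing at the point. As the value group is \<^typ>\<open>int\<close>, the value \<open>\<infinity>\<close> at zero is not
  available; \<open>v\<close> is set to \<open>0\<close> there, so that a place is determined by its values on \<open>F\<^sup>*\<close>.
\<close>

definition places :: "('a, 'm) ring_scheme \<Rightarrow> 'a set \<Rightarrow> ('a \<Rightarrow> int) set" where
  "places F k = {v.
     (\<forall>a. a \<notin> carrier F - {\<zero>\<^bsub>F\<^esub>} \<longrightarrow> v a = 0) \<and>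
     (\<forall>a \<in> carrier F - {\<zero>\<^bsub>F\<^esub>}. \<forall>b \<in> carrier F - {\<zero>\<^bsub>F\<^esub>}.
        v (a \<otimes>\<^bsub>F\<^esub> b) = v a + v b) \<and>
     (\<forall>a \<in> carrier F - {\<zero>\<^bsub>F\<^esub>}. \<forall>b \<in> carrier F - {\<zero>\<^bsub>F\<^esub>}.
        a \<oplus>\<^bsub>F\<^esub> b \<noteq> \<zero>\<^bsub>F\<^esub> \<longrightarrow> min (v a) (v b) \<le> v (a \<oplus>\<^bsub>F\<^esub> b)) \<and>
     (\<forall>c \<in> k - {\<zero>\<^bsub>F\<^esub>}. v c = 0) \<and>
     (\<exists>t \<in> carrier F - {\<zero>\<^bsub>F\<^esub>}. v t = 1)}"

text \<open>The unweighted sum is the degree because all residue fields equal \<open>k\<close>.\<close>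

definition divisor_degree :: "('v \<Rightarrow>\<^sub>0 int) \<Rightarrow> int" where
  "divisor_degree D = (\<Sum>v \<in> Poly_Mapping.keys D. Poly_Mapping.lookup D v)"

definition div0_group :: "('a, 'm) ring_scheme \<Rightarrow> 'a set \<Rightarrow> (('a \<Rightarrow> int) \<Rightarrow>\<^sub>0 int) monoid" where
  "div0_group F k = (free_Abelian_group (places F k))
     \<lparr>carrier := {D \<in> carrier (free_Abelian_group (places F k)). divisor_degree D = 0}\<rparr>"

text \<open>Divisors of functions automatically have degree zero; asking for it in the definition
  saves having to prove this before the quotient can be formed.\<close>

definition principal_divisors :: "('a, 'm) ring_scheme \<Rightarrow> 'a set \<Rightarrow> (('a \<Rightarrow> int) \<Rightarrow>\<^sub>0 int) set" where
  "principal_divisors F k = {D \<in> carrier (div0_group F k).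
     \<exists>\<phi> \<in> carrier F - {\<zero>\<^bsub>F\<^esub>}. \<forall>v \<in> places F k. Poly_Mapping.lookup D v = v \<phi>}"

definition pic0 :: "('a, 'm) ring_scheme \<Rightarrow> 'a set \<Rightarrow> (('a \<Rightarrow> int) \<Rightarrow>\<^sub>0 int) set monoid" where
  "pic0 F k = div0_group F k Mod principal_divisors F k"


section \<open>The function field of the curve \<open>y\<^sup>2 + h(x) y = f(x)\<close>\<close>

text \<open>The pair \<open>(a, b)\<close> stands for \<open>a + b y\<close> with \<open>a, b\<close> in \<open>k(x)\<close>; products are reduced with
  \<open>y\<^sup>2 = f - h y\<close>.\<close>

type_synonym 'k quad_fun = "'k poly fract \<times> 'k poly fract"

definition function_field :: "'k :: field poly \<Rightarrow> 'k poly \<Rightarrow> 'k quad_fun ring" where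
  "function_field h f = \<lparr>
     carrier = UNIV,
     monoid.mult = (\<lambda>(a, b) (c, d).
       (a * c + b * d * Fract f 1, a * d + b * c - b * d * Fract h 1)),
     monoid.one = (1, 0),
     ring.zero = (0, 0),
     ring.add = (\<lambda>(a, b) (c, d). (a + c, b + d))\<rparr>"

definition const_fun :: "'k :: field \<Rightarrow> 'k quad_fun" where
  "const_fun c = (Fract [:c:] 1, 0)"


section \<open>The Jacobian of a curve over \<open>\<rat>\<close> and its rational points\<close>

text \<open>\<^typ>\<open>rat alg_closure\<close> is the algebraic closure of \<open>\<rat>\<close>.\<close>

definition geometric_function_field :: "rat poly \<Rightarrow> rat poly \<Rightarrow> rat alg_closure quad_fun ring" where
  "geometric_function_field h f = function_field (map_poly to_ac h) (map_poly to_ac f)"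

text \<open>The group of points of the Jacobian over the algebraic closure of \<open>\<rat>\<close>, i.e. \<open>Pic\<^sup>0\<close> of the
  base-changed curve.\<close>

definition jacobian ::
    "rat poly \<Rightarrow> rat poly \<Rightarrow> ((rat alg_closure quad_fun \<Rightarrow> int) \<Rightarrow>\<^sub>0 int) set monoid" where
  "jacobian h f = pic0 (geometric_function_field h f) (range const_fun)"

definition absolute_galois_group :: "(rat alg_closure \<Rightarrow> rat alg_closure) set" where
  "absolute_galois_group = {\<sigma>. bij \<sigma> \<and> (\<forall>a b. \<sigma> (a + b) = \<sigma> a + \<sigma> b) \<and>
     (\<forall>a b. \<sigma> (a * b) = \<sigma> a * \<sigma> b) \<and> (\<forall>q. \<sigma> (to_ac q) = to_ac q)}"

text \<open>Action of \<open>\<sigma>\<close> on the coefficients of a rational function. The description is meaningful for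
  injective ring homomorphisms \<open>\<sigma>\<close>, see \<open>map_fract_Fract\<close>.\<close>

definition map_fract :: "('k :: field \<Rightarrow> 'k) \<Rightarrow> 'k poly fract \<Rightarrow> 'k poly fract" where
  "map_fract \<sigma> q = (THE r. \<exists>a b. b \<noteq> 0 \<and> q = Fract a b \<and> r = Fract (map_poly \<sigma> a) (map_poly \<sigma> b))"

lemma map_fract_hom:
  fixes \<sigma> :: "'k :: field \<Rightarrow> 'k"
  assumes inj: "inj \<sigma>" and add: "\<And>a b. \<sigma> (a + b) = \<sigma> a + \<sigma> b"
    and mult: "\<And>a b. \<sigma> (a * b) = \<sigma> a * \<sigma> b"
  shows map_fract_Fract: "q \<noteq> 0 \<Longrightarrow> map_fract \<sigma> (Fract p q) = Fract (map_poly \<sigma> p) (map_poly \<sigma> q)"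
    and map_fract_add: "map_fract \<sigma> (x + y) = map_fract \<sigma> x + map_fract \<sigma> y"
    and map_fract_mult: "map_fract \<sigma> (x * y) = map_fract \<sigma> x * map_fract \<sigma> y"
proof -
  have zero: "\<sigma> 0 = 0" using add[of 0 0] by (metis add.right_neutral add_left_cancel)
  have nz: "\<sigma> a = 0 \<longleftrightarrow> a = 0" for a using inj zero by (metis injD)
  have sum: "\<sigma> (\<Sum>i\<in>A. g i) = (\<Sum>i\<in>A. \<sigma> (g i))" for A :: "nat set" and g
    by (induction A rule: infinite_finite_induct) (auto simp: zero add)
  have mp: "map_poly \<sigma> (a * b) = map_poly \<sigma> a * map_poly \<sigma> b" for a b
    by (rule poly_eqI) (simp add: coeff_map_poly zero coeff_mult sum mult)
  have ma: "map_poly \<sigma> (a + b) = map_poly \<sigma> a + map_poly \<sigma> b" for a b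
    by (rule poly_eqI) (simp add: coeff_map_poly zero add)
  have mp0: "map_poly \<sigma> a = 0 \<longleftrightarrow> a = 0" for a
    by (auto simp: poly_eq_iff coeff_map_poly zero nz)
  show Fract: "map_fract \<sigma> (Fract p q) = Fract (map_poly \<sigma> p) (map_poly \<sigma> q)" if q: "q \<noteq> 0" for p q
    unfolding map_fract_def
  proof (rule the_equality)
    show "\<exists>a b. b \<noteq> 0 \<and> Fract p q = Fract a b \<and>
        Fract (map_poly \<sigma> p) (map_poly \<sigma> q) = Fract (map_poly \<sigma> a) (map_poly \<sigma> b)"
      using q by blast
  next
    fix r
    assume "\<exists>a b. b \<noteq> 0 \<and> Fract p q = Fract a b \<and> r = Fract (map_poly \<sigma> a) (map_poly \<sigma> b)"
    then obtain a b where ab: "b \<noteq> 0" "Fract p q = Fract a b"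
      "r = Fract (map_poly \<sigma> a) (map_poly \<sigma> b)" by blast
    then have "p * b = a * q" using q by (simp add: eq_fract)
    then have "map_poly \<sigma> p * map_poly \<sigma> b = map_poly \<sigma> a * map_poly \<sigma> q" by (metis mp)
    then show "r = Fract (map_poly \<sigma> p) (map_poly \<sigma> q)"
      using ab q by (simp add: eq_fract mp0)
  qed
  obtain a b where x: "x = Fract a b" "b \<noteq> 0" by (cases x)
  obtain c d where y: "y = Fract c d" "d \<noteq> 0" by (cases y)
  show "map_fract \<sigma> (x + y) = map_fract \<sigma> x + map_fract \<sigma> y"
    using x y by (simp add: Fract mp ma mp0)
  show "map_fract \<sigma> (x * y) = map_fract \<sigma> x * map_fract \<sigma> y"
    using x y by (simp add: Fract mp mp0)
qed

definition galois_fun :: "('k :: field \<Rightarrow> 'k) \<Rightarrow> 'k quad_fun \<Rightarrow> 'k quad_fun" where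
  "galois_fun \<sigma> = map_prod (map_fract \<sigma>) (map_fract \<sigma>)"

text \<open>The order of \<open>\<phi>\<close> at \<open>\<sigma>(P)\<close> is the order of \<open>\<sigma>\<^sup>-\<^sup>1(\<phi>)\<close> at \<open>P\<close>.\<close>

definition galois_place :: "('k :: field \<Rightarrow> 'k) \<Rightarrow> ('k quad_fun \<Rightarrow> int) \<Rightarrow> ('k quad_fun \<Rightarrow> int)" where
  "galois_place \<sigma> v = v \<circ> galois_fun (inv_into UNIV \<sigma>)"

definition galois_divisor ::
    "('k :: field \<Rightarrow> 'k) \<Rightarrow> (('k quad_fun \<Rightarrow> int) \<Rightarrow>\<^sub>0 int) \<Rightarrow> (('k quad_fun \<Rightarrow> int) \<Rightarrow>\<^sub>0 int)" where
  "galois_divisor \<sigma> = frag_extend (frag_of \<circ> galois_place \<sigma>)"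

text \<open>The points of the Jacobian defined over \<open>\<rat>\<close> are the geometric points, i.e. divisor
  classes, fixed by the absolute Galois group.\<close>

definition jacobian_rational_points ::
    "rat poly \<Rightarrow> rat poly \<Rightarrow> ((rat alg_closure quad_fun \<Rightarrow> int) \<Rightarrow>\<^sub>0 int) set set" where
  "jacobian_rational_points h f = {P \<in> carrier (jacobian h f).
     \<forall>\<sigma> \<in> absolute_galois_group. galois_divisor \<sigma> ` P = P}"


section \<open>The curve \<open>C\<^sub>7\<^sub>0\<close>\<close>

text \<open>Coefficients are listed from the constant term upwards.\<close>

definition h70 :: "rat poly" where
  "h70 = [:110, - 41, - 3, 2:]"

definition f70 :: "rat poly" where
  "f70 = [:179, 425, - 51, 1:]"

section \<open>Well-definedness: Picard group, irreducibility, Galois action\<close>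

lemma cring_function_field: "cring (function_field h f)"
proof (rule cringI)
  show "abelian_group (function_field h f)"
  proof (rule abelian_groupI)
    fix x assume "x \<in> carrier (function_field h f)"
    show "\<exists>y\<in>carrier (function_field h f). y \<oplus>\<^bsub>function_field h f\<^esub> x = \<zero>\<^bsub>function_field h f\<^esub>"
      by (rule bexI[of _ "(- fst x, - snd x)"]) (auto simp: function_field_def split: prod.splits)
  qed (auto simp: function_field_def algebra_simps)
  show "comm_monoid (function_field h f)"
    by unfold_locales (auto simp: function_field_def algebra_simps)
qed (auto simp: function_field_def algebra_simps)

lemma field_function_field:
  fixes h f :: "'k :: field poly"
  assumes irr: "\<And>t :: 'k poly fract. t * t + Fract h 1 * t \<noteq> Fract f 1"
  shows "field (function_field h f)"
proof -
  interpret cring "function_field h f" by (rule cring_function_field)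
  show ?thesis
  proof (rule cring_fieldI2)
    show "\<zero>\<^bsub>function_field h f\<^esub> \<noteq> \<one>\<^bsub>function_field h f\<^esub>" by (simp add: function_field_def)
  next
    fix z assume z: "z \<noteq> \<zero>\<^bsub>function_field h f\<^esub>"
    obtain a b where ab: "z = (a, b)" by (cases z)
    define H where "H = Fract h 1"
    define F where "F = Fract f 1"
    define N where "N = a * a - a * b * H - b * b * F"
    have N: "N \<noteq> 0"
    proof
      assume "N = 0"
      show False
      proof (cases "b = 0")
        case True
        with \<open>N = 0\<close> z ab show False by (simp add: N_def function_field_def)
      next
        case False
        have "(- a / b) * (- a / b) + H * (- a / b) - F = N / (b * b)"
          using False by (simp add: N_def field_simps)
        with \<open>N = 0\<close> irr[of "- a / b"] show False by (simp add: H_def F_def)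
      qed
    qed
    obtain i where i: "N * i = 1" using N by (metis right_inverse)
    have "z \<otimes>\<^bsub>function_field h f\<^esub> ((a - b * H) * i, - b * i) = (N * i, 0)"
      by (simp add: ab function_field_def N_def H_def F_def algebra_simps)
    with i show "\<exists>w\<in>carrier (function_field h f). z \<otimes>\<^bsub>function_field h f\<^esub> w = \<one>\<^bsub>function_field h f\<^esub>"
      by (auto simp: function_field_def)
  qed
qed

lemma divisor_degree_eq:
  "finite S \<Longrightarrow> Poly_Mapping.keys D \<subseteq> S \<Longrightarrow> divisor_degree D = (\<Sum>v\<in>S. Poly_Mapping.lookup D v)"
  unfolding divisor_degree_def by (rule sum.mono_neutral_left) (auto simp: in_keys_iff)

lemma divisor_degree_add: "divisor_degree (D + E) = divisor_degree D + divisor_degree E"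
proof -
  let ?S = "Poly_Mapping.keys D \<union> Poly_Mapping.keys E"
  have "Poly_Mapping.keys (D + E) \<subseteq> ?S" by (rule Poly_Mapping.keys_add)
  then show ?thesis
    by (simp add: divisor_degree_eq[of ?S] lookup_add sum.distrib)
qed

lemma divisor_degree_minus: "divisor_degree (- D) = - divisor_degree D"
  unfolding divisor_degree_def by (simp add: sum_negf)

lemma comm_group_div0_group: "comm_group (div0_group F k)"
proof -
  interpret comm_group "free_Abelian_group (places F k)" by (rule abelian_free_Abelian_group)
  let ?H = "{D \<in> carrier (free_Abelian_group (places F k)). divisor_degree D = 0}"
  have "0 \<in> ?H" by (simp add: divisor_degree_def)
  then have "?H \<noteq> {}" by blast
  then have "subgroup ?H (free_Abelian_group (places F k))"
    by (intro subgroupI)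
      (auto simp: divisor_degree_add divisor_degree_minus dest: subsetD[OF Poly_Mapping.keys_add])
  then have "group (div0_group F k)"
    unfolding div0_group_def by (rule subgroup_imp_group)
  then show ?thesis
    by (rule group.group_comm_groupI) (simp add: div0_group_def add.commute)
qed

lemma subgroup_principal_divisors:
  assumes "field F"
  shows "subgroup (principal_divisors F k) (div0_group F k)"
proof -
  interpret F: field F by fact
  interpret G: comm_group "div0_group F k" by (rule comm_group_div0_group)
  have v_mult: "v (a \<otimes>\<^bsub>F\<^esub> b) = v a + v b"
    if "v \<in> places F k" "a \<in> carrier F - {\<zero>\<^bsub>F\<^esub>}" "b \<in> carrier F - {\<zero>\<^bsub>F\<^esub>}" for v a b
    using that unfolding places_def by blast
  have v_one: "v \<one>\<^bsub>F\<^esub> = 0" if "v \<in> places F k" for v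
    using v_mult[OF that, of "\<one>\<^bsub>F\<^esub>" "\<one>\<^bsub>F\<^esub>"] by simp
  have mem: "D \<in> carrier (div0_group F k) \<longleftrightarrow>
      Poly_Mapping.keys D \<subseteq> places F k \<and> divisor_degree D = 0" for D
    by (simp add: div0_group_def)
  have mult: "D \<otimes>\<^bsub>div0_group F k\<^esub> E = D + E" for D E by (simp add: div0_group_def)
  have inv: "inv\<^bsub>div0_group F k\<^esub> D = - D" if "D \<in> carrier (div0_group F k)" for D
    by (rule G.inv_equality) (use that in \<open>auto simp: mem mult divisor_degree_minus div0_group_def\<close>)
  show ?thesis
  proof (rule G.subgroupI)
    show "principal_divisors F k \<subseteq> carrier (div0_group F k)" by (auto simp: principal_divisors_def)
    have "0 \<in> principal_divisors F k"
      unfolding principal_divisors_def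
      by (auto simp: mem divisor_degree_def v_one intro!: bexI[of _ "\<one>\<^bsub>F\<^esub>"])
    then show "principal_divisors F k \<noteq> {}" by blast
  next
    fix D assume D: "D \<in> principal_divisors F k"
    then obtain \<phi> where \<phi>: "\<phi> \<in> carrier F - {\<zero>\<^bsub>F\<^esub>}" "\<And>v. v \<in> places F k \<Longrightarrow> Poly_Mapping.lookup D v = v \<phi>"
      unfolding principal_divisors_def by blast
    have i: "inv\<^bsub>F\<^esub> \<phi> \<in> carrier F - {\<zero>\<^bsub>F\<^esub>}" "\<phi> \<otimes>\<^bsub>F\<^esub> inv\<^bsub>F\<^esub> \<phi> = \<one>\<^bsub>F\<^esub>"
      using \<phi>(1) F.field_Units F.Units_inv_Units F.Units_r_inv by (metis, metis)
    have "v (inv\<^bsub>F\<^esub> \<phi>) = - v \<phi>" if "v \<in> places F k" for v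
      using v_mult[OF that \<phi>(1) i(1)] v_one[OF that] i(2) by simp
    with D \<phi> i(1) show "inv\<^bsub>div0_group F k\<^esub> D \<in> principal_divisors F k"
      unfolding principal_divisors_def
      by (auto simp: inv) (auto simp: mem divisor_degree_minus intro!: bexI[of _ "inv\<^bsub>F\<^esub> \<phi>"])
  next
    fix D E assume D: "D \<in> principal_divisors F k" and E: "E \<in> principal_divisors F k"
    obtain \<phi> where \<phi>: "\<phi> \<in> carrier F - {\<zero>\<^bsub>F\<^esub>}" "\<And>v. v \<in> places F k \<Longrightarrow> Poly_Mapping.lookup D v = v \<phi>"
      using D unfolding principal_divisors_def by blast
    obtain \<psi> where \<psi>: "\<psi> \<in> carrier F - {\<zero>\<^bsub>F\<^esub>}" "\<And>v. v \<in> places F k \<Longrightarrow> Poly_Mapping.lookup E v = v \<psi>"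
      using E unfolding principal_divisors_def by blast
    have p: "\<phi> \<otimes>\<^bsub>F\<^esub> \<psi> \<in> carrier F - {\<zero>\<^bsub>F\<^esub>}" using \<phi>(1) \<psi>(1) F.integral_iff by auto
    have "D \<otimes>\<^bsub>div0_group F k\<^esub> E \<in> carrier (div0_group F k)"
      using D E by (auto simp: principal_divisors_def)
    with p \<phi> \<psi> show "D \<otimes>\<^bsub>div0_group F k\<^esub> E \<in> principal_divisors F k"
      unfolding principal_divisors_def mult
      by (auto simp: lookup_add v_mult intro!: bexI[of _ "\<phi> \<otimes>\<^bsub>F\<^esub> \<psi>"])
  qed
qed

lemma comm_group_pic0: "field F \<Longrightarrow> comm_group (pic0 F k)"
  unfolding pic0_def
  by (intro comm_group.abelian_FactGroup comm_group_div0_group subgroup_principal_divisors)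

text \<open>The curve \<open>C\<^sub>7\<^sub>0\<close> is geometrically irreducible.\<close>

instance alg_closure :: (field) field_gcd ..

lemma field_C70: "field (geometric_function_field h70 f70)"
  unfolding geometric_function_field_def
proof (rule field_function_field)
  fix t :: "rat alg_closure poly fract"
  define h where "h = (map_poly to_ac h70 :: rat alg_closure poly)"
  define f where "f = (map_poly to_ac f70 :: rat alg_closure poly)"
  have h: "h = [:110, - 41, - 3, 2:]" and f: "f = [:179, 425, - 51, 1:]"
    by (simp_all add: h_def f_def h70_def f70_def map_poly_pCons)
  show "t * t + Fract (map_poly to_ac h70) 1 * t \<noteq> Fract (map_poly to_ac f70) 1"
    unfolding h_def[symmetric] f_def[symmetric]
  proof
    assume eq: "t * t + Fract h 1 * t = Fract f 1"
    obtain p q where t: "t = Fract p q" "q \<noteq> 0" "coprime p q"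
      using quot_of_fract_in_normalized_fracts[of t] Fract_quot_of_fract[of t]
      by (metis coprime_quot_of_fract snd_quot_of_fract_nonzero)
    have pq: "p * p + h * p * q = f * (q * q)"
    proof -
      have "q * (p * p + h * p * q) = q * (f * (q * q))"
        using eq t(2) by (simp add: t(1) eq_fract algebra_simps)
      then show ?thesis using t(2) by simp
    qed
    then have "p * p = q * (f * q - h * p)" by (simp add: algebra_simps)
    then have "q dvd p * p" by simp
    then have "is_unit q"
      using t(3) by (metis coprime_commute coprime_dvd_mult_left_iff coprime_common_divisor dvd_refl)
    then obtain r where r: "p = q * r" by (metis dvdE unit_imp_dvd)
    have "q * q * (r * (r + h)) = q * q * f" using pq by (simp add: r algebra_simps)
    then have rf: "r * (r + h) = f" using t(2) by simp
    have nz: "r \<noteq> 0" "r + h \<noteq> 0" using rf by (auto simp: f)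
    have deg: "degree r + degree (r + h) = 3"
      using degree_mult_eq[OF nz] by (simp add: rf f)
    have dh: "degree h = 3" by (simp add: h)
    consider "degree r = 0" | "0 < degree r" "degree r < 3" | "degree r = 3" | "degree r > 3"
      by linarith
    then show False
    proof cases
      case 1
      then obtain c where "r = [:c:]" by (metis degree_eq_zeroE)
      with rf have "c * 2 = 1" and "c = 17" by (auto simp: h f algebra_simps)
      then have "(17 :: rat alg_closure) * 2 = 1" by metis
      then show False by simp
    next
      case 2
      then have "degree (r + h) = 3" using dh by (simp add: degree_add_eq_right)
      with 2 deg show False by simp
    next
      case 3
      then have "degree (r + h) = 0" using deg by simp
      then obtain c where "r + h = [:c:]" by (metis degree_eq_zeroE)
      then have "r = [:c:] - h" by (simp add: algebra_simps)
      with rf have "c * 2 = - 1" and "c = - 17" by (auto simp: h f algebra_simps)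
      then have "(- 17 :: rat alg_closure) * 2 = - 1" by metis
      then show False by simp
    next
      case 4
      with deg show False by simp
    qed
  qed
qed

lemma absolute_galois_group_inv:
  assumes "\<sigma> \<in> absolute_galois_group"
  shows "inv_into UNIV \<sigma> \<in> absolute_galois_group"
proof -
  have b: "bij \<sigma>" and h: "\<And>a b. \<sigma> (a + b) = \<sigma> a + \<sigma> b" "\<And>a b. \<sigma> (a * b) = \<sigma> a * \<sigma> b"
    "\<And>q. \<sigma> (to_ac q) = to_ac q"
    using assms by (auto simp: absolute_galois_group_def)
  let ?\<tau> = "inv_into UNIV \<sigma>"
  note i = bij_is_surj[OF b, THEN surj_f_inv_f] bij_is_inj[OF b, THEN inv_f_f]
  have "?\<tau> (x + y) = ?\<tau> x + ?\<tau> y" for x y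
    using i(2)[of "?\<tau> x + ?\<tau> y"] by (simp add: h i(1))
  moreover have "?\<tau> (x * y) = ?\<tau> x * ?\<tau> y" for x y
    using i(2)[of "?\<tau> x * ?\<tau> y"] by (simp add: h i(1))
  moreover have "?\<tau> (to_ac q) = to_ac q" for q
    using i(2)[of "to_ac q"] by (simp add: h)
  ultimately show ?thesis
    unfolding absolute_galois_group_def by (simp add: bij_imp_bij_inv[OF b])
qed

lemma map_fract_map_fract_inv:
  assumes "\<sigma> \<in> absolute_galois_group"
  shows "map_fract (inv_into UNIV \<sigma>) (map_fract \<sigma> x) = x"
proof -
  let ?\<tau> = "inv_into UNIV \<sigma>"
  have s: "inj \<sigma>" "\<And>a b. \<sigma> (a + b) = \<sigma> a + \<sigma> b" "\<And>a b. \<sigma> (a * b) = \<sigma> a * \<sigma> b"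
    using assms by (auto simp: absolute_galois_group_def bij_is_inj)
  have t: "inj ?\<tau>" "\<And>a b. ?\<tau> (a + b) = ?\<tau> a + ?\<tau> b" "\<And>a b. ?\<tau> (a * b) = ?\<tau> a * ?\<tau> b"
    using absolute_galois_group_inv[OF assms] by (auto simp: absolute_galois_group_def bij_is_inj)
  have z: "\<sigma> 0 = 0" "?\<tau> 0 = 0"
    using s(2)[of 0 0] t(2)[of 0 0] by (metis add.right_neutral add_left_cancel)+
  obtain a b where x: "x = Fract a b" "b \<noteq> 0" by (cases x)
  have mm: "map_poly ?\<tau> (map_poly \<sigma> p) = p" for p
    by (rule poly_eqI) (simp add: coeff_map_poly z inv_f_f[OF s(1)])
  then have "map_poly \<sigma> b \<noteq> 0" using x(2) by (metis map_poly_0)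
  then show ?thesis using x by (simp add: map_fract_Fract[OF s] map_fract_Fract[OF t] mm)
qed

lemma galois_place_in_places:
  assumes \<sigma>: "\<sigma> \<in> absolute_galois_group"
    and v: "v \<in> places (geometric_function_field h f) (range const_fun)"
  shows "galois_place \<sigma> v \<in> places (geometric_function_field h f) (range const_fun)"
proof -
  define \<tau> where "\<tau> = inv_into UNIV \<sigma>"
  define F where "F = geometric_function_field h f"
  define g where "g = galois_fun \<tau>"
  have \<tau>: "\<tau> \<in> absolute_galois_group" unfolding \<tau>_def by (rule absolute_galois_group_inv[OF \<sigma>])
  have hom: "inj \<tau>" "\<And>a b. \<tau> (a + b) = \<tau> a + \<tau> b" "\<And>a b. \<tau> (a * b) = \<tau> a * \<tau> b"
    and fix_rat: "\<And>q. \<tau> (to_ac q) = to_ac q"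
    using \<tau> by (auto simp: absolute_galois_group_def bij_is_inj)
  have z: "\<tau> 0 = 0" and o: "\<tau> 1 = 1" using fix_rat[of 0] fix_rat[of 1] by simp_all
  have neg: "\<tau> (- a) = - \<tau> a" for a
    using hom(2)[of a "- a"] z by (simp add: eq_neg_iff_add_eq_0 add.commute)
  have p1: "map_poly \<tau> 1 = 1" by (simp add: o)
  have Frat: "map_fract \<tau> (Fract (map_poly to_ac p) 1) = Fract (map_poly to_ac p) 1" for p
    by (subst map_fract_Fract[OF hom])
      (simp_all add: p1, rule arg_cong[where f = "\<lambda>p. Fract p 1"], rule poly_eqI,
        simp add: coeff_map_poly z fix_rat)
  have m0: "map_fract \<tau> 0 = 0"
    using map_fract_add[OF hom, of 0 0] by (metis add_0 add_left_cancel add.right_neutral)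
  have mneg: "map_fract \<tau> (- x) = - map_fract \<tau> x" for x
    using map_fract_add[OF hom, of x "- x"] m0 by (simp add: eq_neg_iff_add_eq_0 add.commute)
  have mdiff: "map_fract \<tau> (x - y) = map_fract \<tau> x - map_fract \<tau> y" for x y
    using map_fract_add[OF hom, of x "- y"] mneg by simp
  note m = map_fract_add[OF hom] map_fract_mult[OF hom] mdiff Frat
  have gm: "g (a \<otimes>\<^bsub>F\<^esub> b) = g a \<otimes>\<^bsub>F\<^esub> g b" and ga: "g (a \<oplus>\<^bsub>F\<^esub> b) = g a \<oplus>\<^bsub>F\<^esub> g b" for a b
    by (cases a; cases b;
        simp add: g_def galois_fun_def F_def geometric_function_field_def function_field_def m)+
  have car: "carrier F = UNIV" and z0: "\<zero>\<^bsub>F\<^esub> = (0, 0)"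
    by (simp_all add: F_def geometric_function_field_def function_field_def)
  have \<sigma>\<tau>: "inv_into UNIV \<tau> = \<sigma>"
    using \<sigma> by (simp add: \<tau>_def inv_inv_eq absolute_galois_group_def)
  have inv1: "galois_fun \<sigma> (g a) = a" for a
    using map_fract_map_fract_inv[OF \<tau>] by (cases a) (simp add: g_def galois_fun_def \<sigma>\<tau>)
  have inv2: "g (galois_fun \<sigma> a) = a" for a
    using map_fract_map_fract_inv[OF \<sigma>] by (cases a) (simp add: g_def galois_fun_def \<tau>_def)
  have g0: "g a = \<zero>\<^bsub>F\<^esub> \<longleftrightarrow> a = \<zero>\<^bsub>F\<^esub>" for a
  proof -
    have "g \<zero>\<^bsub>F\<^esub> = \<zero>\<^bsub>F\<^esub>" by (simp add: z0 g_def galois_fun_def m0)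
    then show ?thesis by (metis inv1)
  qed
  have gc: "g c \<in> range const_fun" if c: "c \<in> range const_fun" for c
  proof -
    from c obtain a where "c = const_fun a" by blast
    then have "g c = const_fun (\<tau> a)"
      by (simp add: g_def galois_fun_def const_fun_def m0 map_fract_Fract[OF hom] p1 map_poly_pCons z)
    then show ?thesis by simp
  qed
  have V: "\<And>a. a = \<zero>\<^bsub>F\<^esub> \<Longrightarrow> v a = 0"
    "\<And>a b. a \<noteq> \<zero>\<^bsub>F\<^esub> \<Longrightarrow> b \<noteq> \<zero>\<^bsub>F\<^esub> \<Longrightarrow> v (a \<otimes>\<^bsub>F\<^esub> b) = v a + v b"
    "\<And>a b. a \<noteq> \<zero>\<^bsub>F\<^esub> \<Longrightarrow> b \<noteq> \<zero>\<^bsub>F\<^esub> \<Longrightarrow> a \<oplus>\<^bsub>F\<^esub> b \<noteq> \<zero>\<^bsub>F\<^esub> \<Longrightarrow> min (v a) (v b) \<le> v (a \<oplus>\<^bsub>F\<^esub> b)"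
    "\<And>c. c \<in> range const_fun \<Longrightarrow> c \<noteq> \<zero>\<^bsub>F\<^esub> \<Longrightarrow> v c = 0"
    using v unfolding F_def[symmetric] places_def by (simp_all add: car del: min_le_iff_disj)
  have "\<exists>t. t \<noteq> \<zero>\<^bsub>F\<^esub> \<and> v t = 1"
    using v unfolding F_def[symmetric] places_def by blast
  then obtain t where t: "t \<noteq> \<zero>\<^bsub>F\<^esub>" "v t = 1" by blast
  have "v \<circ> g \<in> places F (range const_fun)"
    unfolding places_def
  proof (intro CollectI conjI ballI allI impI)
    show "\<exists>s\<in>carrier F - {\<zero>\<^bsub>F\<^esub>}. (v \<circ> g) s = 1"
    proof (rule bexI[of _ "galois_fun \<sigma> t"])
      show "galois_fun \<sigma> t \<in> carrier F - {\<zero>\<^bsub>F\<^esub>}"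
        using t(1) g0[of "galois_fun \<sigma> t"] by (simp add: car inv2)
    qed (simp add: inv2 t(2))
  next
    fix a assume "a \<notin> carrier F - {\<zero>\<^bsub>F\<^esub>}"
    then show "(v \<circ> g) a = 0" using g0[of a] V(1)[of "g a"] by (simp add: car)
  next
    fix a b assume "a \<in> carrier F - {\<zero>\<^bsub>F\<^esub>}" "b \<in> carrier F - {\<zero>\<^bsub>F\<^esub>}"
    then show "(v \<circ> g) (a \<otimes>\<^bsub>F\<^esub> b) = (v \<circ> g) a + (v \<circ> g) b"
      using g0[of a] g0[of b] V(2)[of "g a" "g b"] by (simp add: gm)
  next
    fix a b assume "a \<in> carrier F - {\<zero>\<^bsub>F\<^esub>}" "b \<in> carrier F - {\<zero>\<^bsub>F\<^esub>}" "a \<oplus>\<^bsub>F\<^esub> b \<noteq> \<zero>\<^bsub>F\<^esub>"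
    then show "min ((v \<circ> g) a) ((v \<circ> g) b) \<le> (v \<circ> g) (a \<oplus>\<^bsub>F\<^esub> b)"
      using g0[of a] g0[of b] g0[of "a \<oplus>\<^bsub>F\<^esub> b"] V(3)[of "g a" "g b"]
      by (simp add: ga del: min_le_iff_disj)
  next
    fix c :: "rat alg_closure quad_fun" assume "c \<in> range const_fun - {\<zero>\<^bsub>F\<^esub>}"
    then show "(v \<circ> g) c = 0" using g0[of c] gc[of c] V(4)[of "g c"] by simp
  qed
  then show ?thesis by (simp add: galois_place_def g_def \<tau>_def F_def)
qed

end

theory Submission
  imports Defs "HOL-Computational_Algebra.Formal_Laurent_Series"
begin

text \<open>
  The class of \<open>A - B\<close> with \<open>A = (2, 17)\<close> and \<open>B = (4, 23)\<close> has order \<open>70\<close>. Three functions whose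
  divisors are supported on \<open>A\<close>, \<open>B\<close>, their conjugates and the two points at infinity generate,
  together with \<open>x - 2\<close> and \<open>x - 4\<close>, all relations needed, and a monomial in them has divisor
  \<open>70 (A - B)\<close>. If \<open>35\<close>, \<open>14\<close> or \<open>10\<close> times \<open>A - B\<close> were principal, the same relations would give a
  function with poles at most twice the divisor at infinity and with different orders at two
  conjugate points. But such functions are polynomials in \<open>x\<close>, as the curve has genus \<open>2\<close>.

  Orders at infinity are read off from leading terms, and at finite places from norms. Only the
  places at \<open>A\<close> and \<open>B\<close> need to be known exactly: they are determined by their centre, which also
  makes them Galois invariant. That every \<open>x\<close>-coordinate carries a place follows by embedding the
  function field into Laurent series.
\<close>

section \<open>Valuations on extensions of an algebraically closed field\<close>

text \<open>Instantiated by the constants of the function field and by those of Laurent series, so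
  that evaluation of polynomials and its rules serve both.\<close>

locale field_embedding =
  fixes \<kappa> :: "'k :: field \<Rightarrow> 'a :: field"
  assumes hom_add: "\<kappa> (a + b) = \<kappa> a + \<kappa> b"
    and hom_mult: "\<kappa> (a * b) = \<kappa> a * \<kappa> b"
    and hom_one: "\<kappa> 1 = 1"
begin

lemma hom_zero [simp]: "\<kappa> 0 = 0"
  using hom_add[of 0 0] by (metis add.right_neutral add_left_cancel)

lemma hom_minus: "\<kappa> (- a) = - \<kappa> a"
  using hom_add[of a "- a"] by (simp add: eq_neg_iff_add_eq_0 add.commute)

lemma hom_eq_0_iff [simp]: "\<kappa> a = 0 \<longleftrightarrow> a = 0"
  by (metis hom_mult hom_one right_inverse mult_zero_left hom_zero zero_neq_one)

lemma hom_numeral: "\<kappa> (numeral n) = numeral n"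
  by (induction n) (simp_all only: numeral.numeral_One numeral.numeral_Bit0 numeral.numeral_Bit1 hom_add hom_one)

definition ev :: "'a \<Rightarrow> 'k poly \<Rightarrow> 'a" where
  "ev u p = poly (map_poly \<kappa> p) u"

lemma ev_0 [simp]: "ev u 0 = 0"
  by (simp add: ev_def)

lemma ev_pCons [simp]: "ev u (pCons a p) = \<kappa> a + u * ev u p"
  by (simp add: ev_def map_poly_pCons)

lemma ev_1 [simp]: "ev u 1 = 1"
  by (simp add: one_pCons hom_one)

lemma ev_add [simp]: "ev u (p + q) = ev u p + ev u q"
proof -
  have "map_poly \<kappa> (p + q) = map_poly \<kappa> p + map_poly \<kappa> q"
    by (rule poly_eqI) (simp add: coeff_map_poly hom_add)
  then show ?thesis by (simp add: ev_def)
qed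

lemma ev_smult [simp]: "ev u (smult c p) = \<kappa> c * ev u p"
  by (induction p) (simp_all add: hom_mult algebra_simps)

lemma ev_mult [simp]: "ev u (p * q) = ev u p * ev u q"
  by (induction p) (simp_all add: algebra_simps)

lemma ev_minus [simp]: "ev u (- p) = - ev u p"
  using ev_add[of u p "- p"] by (simp add: eq_neg_iff_add_eq_0 add.commute del: ev_add)

lemma ev_diff [simp]: "ev u (p - q) = ev u p - ev u q"
  using ev_add[of u p "- q"] by (simp del: ev_add)

lemma ev_power [simp]: "ev u (p ^ n) = ev u p ^ n"
  by (induction n) simp_all

end

locale valued_field = field_embedding \<kappa> for \<kappa> :: "'k :: alg_closed_field \<Rightarrow> 'a :: field" +
  fixes v :: "'a \<Rightarrow> int"
  assumes v_mult: "a \<noteq> 0 \<Longrightarrow> b \<noteq> 0 \<Longrightarrow> v (a * b) = v a + v b"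
    and v_add: "a \<noteq> 0 \<Longrightarrow> b \<noteq> 0 \<Longrightarrow> a + b \<noteq> 0 \<Longrightarrow> min (v a) (v b) \<le> v (a + b)"
    and v_const: "c \<noteq> 0 \<Longrightarrow> v (\<kappa> c) = 0"
begin

text \<open>Only this predicate treats \<open>0\<close> as having infinite valuation.\<close>

definition vge :: "int \<Rightarrow> 'a \<Rightarrow> bool" where
  "vge n a \<longleftrightarrow> a = 0 \<or> n \<le> v a"

lemma v_1 [simp]: "v 1 = 0"
  using v_mult[of 1 1] by simp

lemma v_minus [simp]: "v (- a) = v a"
proof (cases "a = 0")
  case False
  have "v (- 1) = 0" using v_const[of "- 1"] by (simp add: hom_minus hom_one)
  then show ?thesis using v_mult[of "- 1" a] False by simp
qed simp

lemma v_inverse: "a \<noteq> 0 \<Longrightarrow> v (inverse a) = - v a"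
  using v_mult[of a "inverse a"] by simp

lemma v_divide: "a \<noteq> 0 \<Longrightarrow> b \<noteq> 0 \<Longrightarrow> v (a / b) = v a - v b"
  by (simp add: divide_inverse v_mult v_inverse)

lemma v_power: "a \<noteq> 0 \<Longrightarrow> v (a ^ n) = int n * v a"
  by (induction n) (simp_all add: v_mult algebra_simps)

lemma v_power_int: "a \<noteq> 0 \<Longrightarrow> v (a powi n) = n * v a"
  by (cases "n \<ge> 0") (simp_all add: power_int_def v_power v_inverse)

lemma vge_0 [simp]: "vge n 0"
  by (simp add: vge_def)

lemma vge_const [simp]: "n \<le> 0 \<Longrightarrow> vge n (\<kappa> c)"
  by (cases "c = 0") (simp_all add: vge_def v_const)

lemma vge_numeral [simp]: "n \<le> 0 \<Longrightarrow> vge n (numeral m)"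
  using vge_const[of n "numeral m"] by (simp add: hom_numeral)

lemma vge_minus [simp]: "vge n (- a) \<longleftrightarrow> vge n a"
  by (simp add: vge_def)

lemma vge_add: "vge n a \<Longrightarrow> vge n b \<Longrightarrow> vge n (a + b)"
  using v_add[of a b] by (fastforce simp: vge_def)

lemma vge_diff: "vge n a \<Longrightarrow> vge n b \<Longrightarrow> vge n (a - b)"
  using vge_add[of n a "- b"] by simp

lemma vge_mult: "vge m a \<Longrightarrow> vge n b \<Longrightarrow> vge (m + n) (a * b)"
  by (cases "a = 0"; cases "b = 0") (simp_all add: vge_def v_mult)

lemma vge_mono: "vge n a \<Longrightarrow> m \<le> n \<Longrightarrow> vge m a"
  by (auto simp: vge_def)

text \<open>If the sum had larger value than \<open>a\<close>, then \<open>a\<close>, as a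
  difference of two such elements, would too.\<close>

lemma v_add_dominant:
  assumes "a \<noteq> 0" "vge (v a + 1) b"
  shows "a + b \<noteq> 0" "v (a + b) = v a"
proof -
  show nz: "a + b \<noteq> 0"
  proof
    assume "a + b = 0"
    then have "b = - a" by (simp add: eq_neg_iff_add_eq_0 add.commute)
    then show False using assms by (simp add: vge_def)
  qed
  have "vge (v a) (a + b)"
    using assms by (intro vge_add) (auto simp: vge_def)
  moreover have "\<not> vge (v a + 1) (a + b)"
  proof
    assume "vge (v a + 1) (a + b)"
    from vge_diff[OF this assms(2)] show False using assms(1) by (simp add: vge_def)
  qed
  ultimately show "v (a + b) = v a" using nz by (auto simp: vge_def)
qed

section \<open>Values of polynomial expressions in \<open>u\<close>\<close>

lemma vge_ev: "vge 0 u \<Longrightarrow> vge 0 (ev u p)"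
proof (induction p)
  case (pCons a p)
  then show ?case using vge_mult[of 0 u 0 "ev u p"] by (simp add: vge_add)
qed simp

text \<open>Splitting \<open>p = p(c) + (X - c) q\<close> leaves a nonzero constant plus a term of
  positive value.\<close>

lemma ev_unit:
  assumes "vge 1 (u - \<kappa> c)" "poly p c \<noteq> 0"
  shows "ev u p \<noteq> 0" "v (ev u p) = 0"
proof -
  define q where "q = synthetic_div p c"
  have p: "p = [:poly p c:] + [:- c, 1:] * q"
    using synthetic_div_correct'[of c p] by (simp add: q_def algebra_simps)
  have u: "vge 0 u"
    using vge_add[OF vge_mono[OF assms(1), of 0] vge_const[of 0 c]] by simp
  have e: "ev u p = \<kappa> (poly p c) + (u - \<kappa> c) * ev u q"
    by (subst p) (simp add: hom_minus hom_one algebra_simps)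
  have "vge (v (\<kappa> (poly p c)) + 1) ((u - \<kappa> c) * ev u q)"
    using vge_mult[OF assms(1) vge_ev[OF u]] assms(2) by (simp add: v_const)
  from v_add_dominant[OF _ this] show "ev u p \<noteq> 0" "v (ev u p) = 0"
    using assms(2) by (simp_all add: e v_const)
qed

text \<open>By Horner's scheme: at a pole of \<open>u\<close> each new constant coefficient is
  dominated by the part already built, so only the leading term counts.\<close>

lemma ev_infinite:
  assumes "u \<noteq> 0" "v u < 0" "p \<noteq> 0"
  shows "ev u p \<noteq> 0 \<and> v (ev u p) = int (degree p) * v u"
  using assms(3)
proof (induction p)
  case (pCons a p)
  show ?case
  proof (cases "p = 0")
    case True
    with pCons show ?thesis by (simp add: v_const)
  next
    case False
    with pCons have IH: "ev u p \<noteq> 0" "v (ev u p) = int (degree p) * v u" by auto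
    have vX: "v (u * ev u p) = int (degree (pCons a p)) * v u"
      using IH assms False by (simp add: v_mult algebra_simps)
    also have "\<dots> < 0" using assms(2) False by (simp add: mult_pos_neg)
    finally have "vge (v (u * ev u p) + 1) (\<kappa> a)" by simp
    from v_add_dominant[OF _ this] show ?thesis using IH assms(1) vX by (simp add: add.commute)
  qed
qed simp

text \<open>Makes \<open>u\<close> transcendental over the constants: once all factors
  \<open>X - c\<close> are split off, the cofactor evaluates to a unit by
  \<open>ev_unit\<close>.\<close>

lemma ev_ne_0:
  assumes "vge 1 (u - \<kappa> c)" "u \<noteq> \<kappa> c" "p \<noteq> 0"
  shows "ev u p \<noteq> 0"
proof -
  obtain q where q: "p = [:- c, 1:] ^ order c p * q" "\<not> [:- c, 1:] dvd q"
    using order_decomp[OF assms(3)] by blast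
  then have "poly q c \<noteq> 0" by (simp add: poly_eq_0_iff_dvd)
  then have "ev u q \<noteq> 0" by (rule ev_unit[OF assms(1)])
  with assms(2) show ?thesis by (subst q(1)) (simp add: hom_minus hom_one)
qed

text \<open>Multiplication by the unit \<open>y + h + d\<close>, the conjugate of \<open>y - d\<close> up to sign, turns \<open>y - d\<close>
  into a multiple of \<open>u - c\<close>: away from ramification \<open>u - c\<close> is a uniformiser.\<close>

lemma valuation_at_unramified_point:
  assumes w: "valued_field \<kappa> w"
    and curve: "y * y + ev u h * y = ev u f"
    and point: "d * d + poly h c * d = poly f c" and unram: "2 * d + poly h c \<noteq> 0"
    and centre_v: "vge 1 (u - \<kappa> c)" "vge 1 (y - \<kappa> d)"
    and centre_w: "valued_field.vge w 1 (u - \<kappa> c)" "valued_field.vge w 1 (y - \<kappa> d)"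
    and u: "u \<noteq> \<kappa> c" and nz: "ev u a + ev u b * y \<noteq> 0"
  shows "\<exists>n. v (ev u a + ev u b * y) = n * v (u - \<kappa> c) \<and> w (ev u a + ev u b * y) = n * w (u - \<kappa> c)"
  using nz
\<comment> \<open>Each round divides by \<open>u - \<kappa> c\<close> up to a unit and lowers the
  value under \<open>v\<close>; the number \<open>n\<close> of rounds is common to both
  valuations.\<close>
proof (induction "nat (v (ev u a + ev u b * y))" arbitrary: a b rule: less_induct)
  case less
  interpret w: valued_field \<kappa> w by (rule w)
  have unit: "z + r \<noteq> 0 \<and> v (z + r) = 0 \<and> w (z + r) = 0"
    if "z = ev u p" "poly p c \<noteq> 0" "vge 1 r" "w.vge 1 r" for z r p
    using v_add_dominant[of z r] w.v_add_dominant[of z r] that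
      ev_unit[OF centre_v(1), of p] w.ev_unit[OF centre_w(1), of p] by simp
  have pos: "vge 1 (ev u p * (y - \<kappa> d))" "w.vge 1 (ev u p * (y - \<kappa> d))" for p
  proof -
    have "vge 0 u"
      using vge_add[OF vge_mono[OF centre_v(1), of 0] vge_const[of 0 c]] by simp
    then show "vge 1 (ev u p * (y - \<kappa> d))"
      using vge_mult[OF vge_ev centre_v(2), of u p] by simp
    have "w.vge 0 u"
      using w.vge_add[OF w.vge_mono[OF centre_w(1), of 0] w.vge_const[of 0 c]] by simp
    then show "w.vge 1 (ev u p * (y - \<kappa> d))"
      using w.vge_mult[OF w.vge_ev centre_w(2), of u p] by simp
  qed
  have split: "ev u a + ev u b * y = ev u (a + smult d b) + ev u b * (y - \<kappa> d)" for a b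
    by (simp add: algebra_simps)
  show ?case
  proof (cases "poly (a + smult d b) c = 0")
    case False
    have "v (ev u a + ev u b * y) = 0 \<and> w (ev u a + ev u b * y) = 0"
      unfolding split using unit[OF refl False pos] by blast
    then show ?thesis by (intro exI[of _ 0]) simp
  next
    case True
    obtain q where q: "a + smult d b = [:- c, 1:] * q"
      using True poly_eq_0_iff_dvd by blast
    have "poly (f - smult d h - [:d * d:]) c = 0"
      using point by (simp add: algebra_simps)
    then obtain g where g: "f - smult d h - [:d * d:] = [:- c, 1:] * g"
      using poly_eq_0_iff_dvd by blast
    define U where "U = y + ev u h + \<kappa> d"
    have U: "U \<noteq> 0" "v U = 0" "w U = 0"
    proof -
      have "U = ev u (h + [:2 * d:]) + ev u 1 * (y - \<kappa> d)"
        by (simp add: U_def hom_mult hom_numeral algebra_simps)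
      moreover have "poly (h + [:2 * d:]) c \<noteq> 0" using unram by (simp add: algebra_simps)
      ultimately show "U \<noteq> 0" "v U = 0" "w U = 0" using unit[OF refl _ pos] by metis+
    qed
    \<comment> \<open>The coefficients of the quotient of \<open>U * \<psi>\<close> by
      \<open>u - \<kappa> c\<close>, found by expanding with the curve equation.\<close>
    let ?a = "q * (h + [:d:]) + b * g" and ?b = q
    define \<psi> where "\<psi> = ev u a + ev u b * y"
    define \<psi>' where "\<psi>' = ev u ?a + ev u ?b * y"
    have 1: "ev u a = (u - \<kappa> c) * ev u q - \<kappa> d * ev u b"
      using arg_cong[OF q, of "ev u"] by (simp add: hom_minus hom_one algebra_simps)
    have 2: "ev u f - \<kappa> d * ev u h - \<kappa> d * \<kappa> d = (u - \<kappa> c) * ev u g"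
      using arg_cong[OF g, of "ev u"] by (simp add: hom_minus hom_one hom_mult algebra_simps)
    have "U * \<psi> = (u - \<kappa> c) * ev u q * U + ev u b * (y * y + ev u h * y - \<kappa> d * ev u h - \<kappa> d * \<kappa> d)"
      by (simp add: \<psi>_def U_def 1 algebra_simps)
    also have "\<dots> = (u - \<kappa> c) * \<psi>'"
      unfolding curve 2 by (simp add: \<psi>'_def U_def algebra_simps)
    finally have eq: "U * \<psi> = (u - \<kappa> c) * \<psi>'" .
    have nz: "\<psi> \<noteq> 0" "u - \<kappa> c \<noteq> 0" using less.prems u by (simp_all add: \<psi>_def)
    then have nz': "\<psi>' \<noteq> 0" using eq U(1) by auto
    have v: "v \<psi> = v (u - \<kappa> c) + v \<psi>'" and w: "w \<psi> = w (u - \<kappa> c) + w \<psi>'"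
      using arg_cong[OF eq, of v] arg_cong[OF eq, of w] U nz nz'
      by (simp_all add: v_mult w.v_mult)
    have "vge 0 \<psi>'"
    proof -
      have "vge 0 u" "vge 0 y"
        using vge_add[OF vge_mono[OF centre_v(1), of 0] vge_const[of 0 c]]
          vge_add[OF vge_mono[OF centre_v(2), of 0] vge_const[of 0 d]] by simp_all
      then show ?thesis unfolding \<psi>'_def
        by (intro vge_add vge_ev) (use vge_mult[OF vge_ev, of u 0 y q] in simp_all)
    qed
    moreover have "v (u - \<kappa> c) \<ge> 1" using centre_v(1) nz by (simp add: vge_def)
    ultimately have "nat (v \<psi>') < nat (v \<psi>)" using nz' v by (simp add: vge_def)
    from less.hyps[OF this[unfolded \<psi>_def \<psi>'_def] nz'[unfolded \<psi>'_def]]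
    obtain n where "v \<psi>' = n * v (u - \<kappa> c)" "w \<psi>' = n * w (u - \<kappa> c)"
      unfolding \<psi>'_def by blast
    then have "v \<psi> = (n + 1) * v (u - \<kappa> c) \<and> w \<psi> = (n + 1) * w (u - \<kappa> c)"
      by (simp add: v w algebra_simps)
    then show ?thesis unfolding \<psi>_def by blast
  qed
qed

text \<open>By \<open>valuation_at_unramified_point\<close> the values of \<open>v\<close> and
  \<open>w\<close> are the same multiples of their values at \<open>u - \<kappa> c\<close>. As both
  valuations take the value \<open>1\<close>, these two positive integers divide
  \<open>1\<close>.\<close>

lemma place_at_unramified_point:
  assumes w: "valued_field \<kappa> w"
    and curve: "y * y + ev u h * y = ev u f"
    and gen: "\<And>\<phi>. \<exists>a b e. ev u e \<noteq> 0 \<and> \<phi> = (ev u a + ev u b * y) / ev u e"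
    and point: "d * d + poly h c * d = poly f c" and unram: "2 * d + poly h c \<noteq> 0"
    and centre_v: "vge 1 (u - \<kappa> c)" "vge 1 (y - \<kappa> d)"
    and centre_w: "valued_field.vge w 1 (u - \<kappa> c)" "valued_field.vge w 1 (y - \<kappa> d)"
    and u: "u \<noteq> \<kappa> c"
    and onto: "s \<noteq> 0" "v s = 1" "t \<noteq> 0" "w t = 1"
  shows "v (u - \<kappa> c) = 1" "\<phi> \<noteq> 0 \<Longrightarrow> v \<phi> = w \<phi>"
proof -
  interpret w: valued_field \<kappa> w by (rule w)
  note * = valuation_at_unramified_point[OF w curve point unram centre_v centre_w u]
  have ex: "\<exists>n. v \<phi> = n * v (u - \<kappa> c) \<and> w \<phi> = n * w (u - \<kappa> c)" if nz: "\<phi> \<noteq> 0" for \<phi>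
  proof -
    obtain a b e where e: "ev u e \<noteq> 0" and \<phi>: "\<phi> = (ev u a + ev u b * y) / ev u e"
      using gen[of \<phi>] by blast
    have n: "ev u a + ev u b * y \<noteq> 0" using nz \<phi> by auto
    obtain m where m: "v (ev u a + ev u b * y) = m * v (u - \<kappa> c)" "w (ev u a + ev u b * y) = m * w (u - \<kappa> c)"
      using *[OF n] by blast
    \<comment> \<open>The denominator is the case of coefficient \<open>0\<close> at
      \<open>y\<close>.\<close>
    obtain k where k: "v (ev u e) = k * v (u - \<kappa> c)" "w (ev u e) = k * w (u - \<kappa> c)"
      using *[of e 0] e by auto
    have "v \<phi> = (m - k) * v (u - \<kappa> c) \<and> w \<phi> = (m - k) * w (u - \<kappa> c)"
      using n e m k by (simp add: \<phi> v_divide w.v_divide left_diff_distrib)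
    then show ?thesis by blast
  qed
  have "v (u - \<kappa> c) \<ge> 1" "w (u - \<kappa> c) \<ge> 1"
    using centre_v(1) centre_w(1) u by (auto simp: vge_def w.vge_def)
  moreover obtain m where "m * v (u - \<kappa> c) = 1" using ex[OF onto(1)] onto(2) by metis
  moreover obtain n where "n * w (u - \<kappa> c) = 1" using ex[OF onto(3)] onto(4) by metis
  ultimately have *: "v (u - \<kappa> c) = 1" "w (u - \<kappa> c) = 1"
    by (auto simp: zmult_eq_1_iff)
  show "v (u - \<kappa> c) = 1" by fact
  show "v \<phi> = w \<phi>" if "\<phi> \<noteq> 0" using ex[OF that] * by auto
qed

end


section \<open>Laurent series\<close>

interpretation fls: valued_field "fls_const :: 'k :: alg_closed_field \<Rightarrow> 'k fls" fls_subdegree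
proof unfold_locales
  fix a b :: "'k fls"
  assume "a + b \<noteq> 0"
  then show "min (fls_subdegree a) (fls_subdegree b) \<le> fls_subdegree (a + b)"
    by (rule fls_plus_subdegree)
qed (simp_all add: fls_plus_const)

text \<open>After an even power of the variable is split off, a power series with nonzero constant
  term remains. Its constant term has a square root in the field, which extends to the series in
  characteristic zero.\<close>

lemma fls_sqrt:
  fixes F :: "'k :: {alg_closed_field, field_char_0} fls"
  assumes "F \<noteq> 0" "even (fls_subdegree F)"
  shows "\<exists>Z. Z * Z = F"
proof -
  define n where "n = fls_subdegree F div 2"
  define g where "g = fls_base_factor_to_fps F"
  have g: "g $ 0 \<noteq> 0" unfolding g_def by (rule fls_base_factor_to_fps_base[OF assms(1)])
  obtain r where r: "r ^ 2 = g $ 0" using nth_root_exists[of 2 "g $ 0"] by auto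
  define R where "R = fps_radical (\<lambda>_ _. r) 2 g"
  have "R ^ 2 = g"
    using power_radical[OF g, of "\<lambda>_ _. r" 1] r by (simp add: R_def numeral_2_eq_2)
  then have "fps_to_fls R * fps_to_fls R = fps_to_fls g"
    by (simp add: power2_eq_square flip: fls_times_fps_to_fls)
  then have "fls_shift (- n) (fps_to_fls R) * fls_shift (- n) (fps_to_fls R) = F"
    using assms(2) unfolding fls_times_both_shifted_simp
    using fls_conv_base_factor_to_fps_shift_subdegree[of F] by (simp add: n_def g_def)
  then show ?thesis by blast
qed

section \<open>The function field of \<open>C\<^sub>7\<^sub>0\<close> over the algebraic numbers\<close>

type_synonym qbar = "rat alg_closure"

definition h_C :: "qbar poly" where "h_C = [:110, - 41, - 3, 2:]"

definition f_C :: "qbar poly" where "f_C = [:179, 425, - 51, 1:]"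

lemma h_C: "map_poly to_ac h70 = h_C" and f_C: "map_poly to_ac f70 = f_C"
  by (simp_all add: h_C_def f_C_def h70_def f70_def map_poly_pCons)

text \<open>Wrapping the pairs in a type of their own lets the function field become an instance of
  class \<open>field\<close>, so that field arithmetic and the valuation locale apply to it.\<close>

datatype ff = Fn "qbar poly fract" "qbar poly fract"

definition of_pair :: "qbar quad_fun \<Rightarrow> ff" where
  "of_pair = (\<lambda>(a, b). Fn a b)"

definition to_pair :: "ff \<Rightarrow> qbar quad_fun" where
  "to_pair z = (case z of Fn a b \<Rightarrow> (a, b))"

lemma of_pair_to_pair [simp]: "of_pair (to_pair z) = z" "to_pair (of_pair q) = q"
  by (simp_all add: of_pair_def to_pair_def split: ff.splits prod.splits)

lemma to_pair_Fn [simp]: "to_pair (Fn a b) = (a, b)"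
  by (simp add: to_pair_def)

abbreviation C70 :: "qbar quad_fun ring" where
  "C70 \<equiv> geometric_function_field h70 f70"

instantiation ff :: field
begin

definition "0 = Fn 0 0"
definition "1 = Fn 1 0"
definition "z + w = of_pair (to_pair z \<oplus>\<^bsub>C70\<^esub> to_pair w)"
definition "z * w = of_pair (to_pair z \<otimes>\<^bsub>C70\<^esub> to_pair w)"
definition "- z = (case z of Fn a b \<Rightarrow> Fn (- a) (- b))"
definition "z - w = z + (- w :: ff)"
definition "inverse z = (if z = 0 then 0 else SOME w. w * z = (1 :: ff))"
definition "z div w = z * (inverse w :: ff)"

lemma Fn_plus [simp]: "Fn a b + Fn c d = Fn (a + c) (b + d)"
  by (simp add: plus_ff_def of_pair_def geometric_function_field_def function_field_def)

lemma Fn_times: "Fn a b * Fn c d =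
    Fn (a * c + b * d * Fract f_C 1) (a * d + b * c - b * d * Fract h_C 1)"
  by (simp add: times_ff_def of_pair_def geometric_function_field_def function_field_def h_C f_C)

instance
proof
  fix z w r :: ff
  obtain a b where z: "z = Fn a b" by (cases z)
  obtain c d where w: "w = Fn c d" by (cases w)
  obtain p q where r: "r = Fn p q" by (cases r)
  show "z + w + r = z + (w + r)" "z + w = w + z" "0 + z = z" "- z + z = 0" "z - w = z + - w"
    by (simp_all add: z w r zero_ff_def uminus_ff_def minus_ff_def algebra_simps)
  show "z * w * r = z * (w * r)" "z * w = w * z" "1 * z = z" "(z + w) * r = z * r + w * r"
    by (simp_all add: z w r Fn_times one_ff_def algebra_simps)
  show "(0 :: ff) \<noteq> 1" by (simp add: zero_ff_def one_ff_def)
  show "inverse (0 :: ff) = 0" by (simp add: inverse_ff_def)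
  show "z div w = z * inverse w" by (simp add: divide_ff_def)
  show "inverse z * z = 1" if "z \<noteq> 0"
  proof -
    \<comment> \<open>Inverses come from the ring record, where they exist because the curve
      equation is irreducible.\<close>
    interpret F: field C70 by (rule field_C70)
    have c: "carrier C70 = UNIV" "\<zero>\<^bsub>C70\<^esub> = (0, 0)" "\<one>\<^bsub>C70\<^esub> = (1, 0)"
      by (simp_all add: geometric_function_field_def function_field_def)
    have "to_pair z \<in> Units C70"
      using that by (simp add: F.field_Units c z zero_ff_def)
    then have "inv\<^bsub>C70\<^esub> (to_pair z) \<otimes>\<^bsub>C70\<^esub> to_pair z = \<one>\<^bsub>C70\<^esub>"
      by (rule F.Units_l_inv)
    then have "of_pair (inv\<^bsub>C70\<^esub> (to_pair z)) * z = 1"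
      by (simp add: times_ff_def c) (simp add: of_pair_def one_ff_def)
    then show ?thesis using that by (auto simp: inverse_ff_def intro: someI)
  qed
qed

end

definition cst :: "qbar \<Rightarrow> ff" where
  "cst c = Fn (Fract [:c:] 1) 0"

lemma cst: "to_pair (cst c) = const_fun c"
  by (simp add: cst_def const_fun_def)

interpretation cst: field_embedding cst
  by unfold_locales
    (simp_all add: cst_def Fn_times one_ff_def mult.commute flip: One_fract_def one_pCons)

definition xx :: ff where "xx = Fn (Fract [:0, 1:] 1) 0"

definition yy :: ff where "yy = Fn 0 1"

lemma ev_xx: "cst.ev xx p = Fn (Fract p 1) 0"
proof (induction p)
  case 0
  show ?case by (simp add: zero_ff_def Zero_fract_def)
next
  case (pCons a p)
  have "pCons a p = [:a:] + [:0, 1:] * p" by simp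
  then have "Fn (Fract (pCons a p) 1) 0 = cst a + xx * Fn (Fract p 1) 0"
    by (simp add: cst_def xx_def Fn_times)
  then show ?case by (simp add: pCons.IH)
qed

lemma ev_xx_eq_0 [simp]: "cst.ev xx p = 0 \<longleftrightarrow> p = 0"
  by (simp add: ev_xx zero_ff_def eq_fract Zero_fract_def)

lemma Fn_Fract: "b \<noteq> 0 \<Longrightarrow> Fn (Fract a b) 0 = cst.ev xx a / cst.ev xx b"
proof -
  assume b: "b \<noteq> 0"
  have "Fn (Fract a b) 0 * cst.ev xx b = cst.ev xx a"
    using b by (simp add: ev_xx Fn_times eq_fract)
  then show ?thesis using b by (simp add: nonzero_eq_divide_eq)
qed

text \<open>By passing to a common denominator. This is the shape in which
  \<open>place_at_unramified_point\<close> expects its functions.\<close>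

lemma ff_repr: "\<exists>a b e. cst.ev xx e \<noteq> 0 \<and> \<phi> = (cst.ev xx a + cst.ev xx b * yy) / cst.ev xx e"
proof -
  obtain p q where \<phi>: "\<phi> = Fn p q" by (cases \<phi>)
  obtain a e where p: "p = Fract a e" "e \<noteq> 0" by (cases p)
  obtain b d where q: "q = Fract b d" "d \<noteq> 0" by (cases q)
  have "\<phi> = Fn p 0 + Fn q 0 * yy" by (simp add: \<phi> yy_def Fn_times)
  also have "\<dots> = (cst.ev xx (a * d) + cst.ev xx (b * e) * yy) / cst.ev xx (e * d)"
    using p q by (simp add: Fn_Fract field_simps)
  finally show ?thesis using p q by (metis ev_xx_eq_0 mult_eq_0_iff)
qed

lemma curve: "yy * yy + cst.ev xx h_C * yy = cst.ev xx f_C"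
  by (simp add: ev_xx yy_def Fn_times flip: Zero_fract_def)

lemmas ff_hom = cst.hom_add cst.hom_mult cst.hom_one cst.hom_minus cst.hom_numeral

section \<open>The hyperelliptic involution, which fixes \<open>x\<close> and sends \<open>y\<close>
  to \<open>- h - y\<close>\<close>

definition invol :: "ff \<Rightarrow> ff" where
  "invol z = (case z of Fn a b \<Rightarrow> Fn (a - b * Fract h_C 1) (- b))"

lemma invol_add: "invol (z + w) = invol z + invol w"
  by (cases z; cases w) (simp add: invol_def algebra_simps)

lemma invol_mult: "invol (z * w) = invol z * invol w"
  by (cases z; cases w) (simp add: invol_def Fn_times algebra_simps)

lemma invol_invol [simp]: "invol (invol z) = z"
  by (cases z) (simp add: invol_def)

lemma invol_Fn_0 [simp]: "invol (Fn a 0) = Fn a 0"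
  by (simp add: invol_def)

lemma invol_0 [simp]: "invol 0 = 0" and invol_cst [simp]: "invol (cst c) = cst c"
  and invol_xx [simp]: "invol xx = xx"
  by (simp_all add: zero_ff_def cst_def xx_def)

lemma invol_ev [simp]: "invol (cst.ev xx p) = cst.ev xx p"
  by (simp add: ev_xx)

lemma invol_eq_0 [simp]: "invol z = 0 \<longleftrightarrow> z = 0"
  by (metis invol_invol invol_0)

lemma invol_minus: "invol (- z) = - invol z"
  using invol_add[of z "- z"] by (simp add: eq_neg_iff_add_eq_0 add.commute)

lemma invol_diff: "invol (z - w) = invol z - invol w"
  using invol_add[of z "- w"] by (simp add: invol_minus)

lemma invol_numeral [simp]: "invol (numeral n) = numeral n"
  using invol_cst[of "numeral n"] by (simp add: ff_hom)

section \<open>Places\<close>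

definition place :: "(ff \<Rightarrow> int) \<Rightarrow> bool" where
  "place v \<longleftrightarrow> valued_field cst v \<and> v 0 = 0 \<and> (\<exists>t. t \<noteq> 0 \<and> v t = 1)"

lemma placeD:
  assumes "place v"
  shows place_valued: "valued_field cst v" and place_0: "v 0 = 0"
  using assms by (simp_all add: place_def)

text \<open>Carries the places of the ring record over to \<open>ff\<close> along the bijection
  \<open>to_pair\<close>.\<close>

lemma places_iff: "v \<in> places C70 (range const_fun) \<longleftrightarrow> place (v \<circ> to_pair)"
proof -
  have c: "carrier C70 = UNIV" "\<zero>\<^bsub>C70\<^esub> = to_pair 0"
    by (simp_all add: geometric_function_field_def function_field_def zero_ff_def)
  have m: "to_pair z \<otimes>\<^bsub>C70\<^esub> to_pair w = to_pair (z * w)"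
    "to_pair z \<oplus>\<^bsub>C70\<^esub> to_pair w = to_pair (z + w)" for z w
    by (simp_all add: times_ff_def plus_ff_def)
  have inj: "to_pair z = to_pair w \<longleftrightarrow> z = w" for z w by (metis of_pair_to_pair(1))
  have all: "(\<forall>q. P q) \<longleftrightarrow> (\<forall>z. P (to_pair z))" for P by (metis of_pair_to_pair(2))
  have ex: "(\<exists>q. P q) \<longleftrightarrow> (\<exists>z. P (to_pair z))" for P by (metis of_pair_to_pair(2))
  have k: "(\<forall>c\<in>range const_fun - {\<zero>\<^bsub>C70\<^esub>}. v c = 0) \<longleftrightarrow> (\<forall>c. c \<noteq> 0 \<longrightarrow> v (to_pair (cst c)) = 0)"
    by (auto simp: c simp flip: cst simp: inj)
  show ?thesis
    unfolding places_def mem_Collect_eq k place_def valued_field_def valued_field_axioms_def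
    by (simp add: c Ball_def Bex_def all ex m inj cst.field_embedding_axioms
          del: min_le_iff_disj split_paired_All split_paired_Ex) blast
qed

lemma place_invol:
  assumes "place v"
  shows "place (v \<circ> invol)"
proof -
  interpret valued_field cst v by (rule place_valued[OF assms])
  obtain t where "t \<noteq> 0" "v t = 1" using assms by (auto simp: place_def)
  then have t: "invol t \<noteq> 0" "(v \<circ> invol) (invol t) = 1" by simp_all
  have nz: "z + w \<noteq> 0 \<Longrightarrow> invol z + invol w \<noteq> 0" for z w by (simp flip: invol_add)
  have "valued_field cst (v \<circ> invol)"
    by unfold_locales (simp_all add: invol_mult invol_add v_mult v_add[OF _ _ nz] v_const del: min_le_iff_disj)
  moreover have "(v \<circ> invol) 0 = 0" using place_0[OF assms] by simp
  ultimately show ?thesis using t unfolding place_def by blast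
qed

subsection \<open>Existence\<close>

text \<open>Every point of the curve over Laurent series embeds the function field into Laurent series.\<close>

lemma place_of_laurent_point:
  fixes u y :: "qbar fls"
  assumes curve: "y * y + fls.ev u h_C * y = fls.ev u f_C"
    and transc: "\<And>p. p \<noteq> 0 \<Longrightarrow> fls.ev u p \<noteq> 0"
    and onto: "\<bar>fls_subdegree (fls.ev u a + fls.ev u b * y)\<bar> = 1"
  shows "\<exists>v. place v \<and> (\<forall>p. p \<noteq> 0 \<longrightarrow> v (cst.ev xx p) = fls_subdegree (fls.ev u p))"
proof -
  \<comment> \<open>Evaluation is extended to fractions through a chosen representative; the next
    fact shows that every other one gives the same value.\<close>
  define E where "E q = fls.ev u (fst (quot_of_fract q)) / fls.ev u (snd (quot_of_fract q))" for q
  have E: "E (Fract p q) = fls.ev u p / fls.ev u q" if q: "q \<noteq> 0" for p q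
  proof -
    define r s where "r = fst (quot_of_fract (Fract p q))" and "s = snd (quot_of_fract (Fract p q))"
    have s: "s \<noteq> 0" by (simp add: s_def)
    have "Fract r s = Fract p q" by (simp add: r_def s_def Fract_quot_of_fract)
    then have "r * q = p * s" using s q by (simp add: eq_fract)
    from arg_cong[OF this, of "fls.ev u"] show ?thesis
      using transc[OF s] transc[OF q] by (simp add: E_def r_def[symmetric] s_def[symmetric] field_simps)
  qed
  have E_poly: "E (Fract p 1) = fls.ev u p" for p by (simp add: E)
  have E_add: "E (p + q) = E p + E q" for p q
    by (cases p; cases q) (simp add: E transc field_simps)
  have E_mult: "E (p * q) = E p * E q" for p q
    by (cases p; cases q) (simp add: E transc)
  have E_minus: "E (- p) = - E p" for p
    by (cases p) (simp add: E)
  have E_diff: "E (p - q) = E p - E q" for p q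
    using E_add[of p "- q"] by (simp add: E_minus)
  have E_0: "E 0 = 0" and E_1: "E 1 = 1"
    using E[of 1 0] E[of 1 1] by (simp_all flip: Zero_fract_def One_fract_def)
  define \<epsilon> where "\<epsilon> z = (case z of Fn a b \<Rightarrow> E a + E b * y)" for z
  have \<epsilon>_mult: "\<epsilon> (z * w) = \<epsilon> z * \<epsilon> w" for z w
  proof -
    obtain a b where z: "z = Fn a b" by (cases z)
    obtain c d where w: "w = Fn c d" by (cases w)
    have "\<epsilon> z * \<epsilon> w = E a * E c + (E a * E d + E b * E c) * y + E b * E d * (y * y)"
      by (simp add: \<epsilon>_def z w algebra_simps)
    also have "y * y = fls.ev u f_C - fls.ev u h_C * y" using curve by (simp add: algebra_simps)
    finally show ?thesis
      by (simp add: \<epsilon>_def z w Fn_times E_add E_mult E_diff E_poly algebra_simps)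
  qed
  have \<epsilon>_add: "\<epsilon> (z + w) = \<epsilon> z + \<epsilon> w" for z w
    by (cases z; cases w) (simp add: \<epsilon>_def E_add algebra_simps)
  have \<epsilon>_1: "\<epsilon> 1 = 1" and \<epsilon>_0: "\<epsilon> 0 = 0"
    by (simp_all add: \<epsilon>_def one_ff_def zero_ff_def E_0 E_1)
  have \<epsilon>_nz: "\<epsilon> z \<noteq> 0" if "z \<noteq> 0" for z
    using \<epsilon>_mult[of z "inverse z"] that \<epsilon>_1 by auto
  have \<epsilon>_cst: "\<epsilon> (cst c) = fls_const c" for c
    by (simp add: \<epsilon>_def cst_def E_poly E_0)
  have \<epsilon>_ev: "\<epsilon> (cst.ev xx p) = fls.ev u p" for p
    by (simp add: ev_xx \<epsilon>_def E_poly E_0)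
  define v where "v z = fls_subdegree (\<epsilon> z)" for z
  have nz: "z + w \<noteq> 0 \<Longrightarrow> \<epsilon> z + \<epsilon> w \<noteq> 0" for z w
    using \<epsilon>_nz[of "z + w"] by (simp add: \<epsilon>_add)
  interpret v: valued_field cst v
    by unfold_locales
      (simp_all add: v_def \<epsilon>_mult \<epsilon>_add \<epsilon>_cst \<epsilon>_nz fls_plus_subdegree nz del: min_le_iff_disj)
  let ?t = "cst.ev xx a + cst.ev xx b * yy"
  have "\<epsilon> ?t = fls.ev u a + fls.ev u b * y"
    by (simp add: \<epsilon>_add \<epsilon>_mult \<epsilon>_ev) (simp add: \<epsilon>_def yy_def E_0 E_1)
  then have t: "\<bar>v ?t\<bar> = 1" using onto by (simp add: v_def)
  then have "?t \<noteq> 0" by (auto simp: v_def \<epsilon>_0)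
  \<comment> \<open>A value \<open>- 1\<close> is repaired by taking the inverse; this happens at
    infinity, where \<open>x\<close> has order \<open>- 1\<close>.\<close>
  with t have "\<exists>t. t \<noteq> 0 \<and> v t = 1"
    using v.v_inverse[of ?t] by (metis abs_if inverse_nonzero_iff_nonzero minus_minus)
  then have "place v"
    using v.valued_field_axioms by (simp add: place_def) (simp add: v_def \<epsilon>_0)
  moreover have "v (cst.ev xx p) = fls_subdegree (fls.ev u p)" for p
    by (simp add: v_def \<epsilon>_ev)
  ultimately show ?thesis by blast
qed

section \<open>The discriminant of the equation in \<open>y\<close> and its simple roots\<close>

definition disc :: "qbar poly" where
  "disc = h_C * h_C + smult 4 f_C"

lemma disc_explicit: "disc = [:12816, - 7320, 817, 690, - 155, - 12, 4:]"
  by (simp add: disc_def h_C_def f_C_def)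

lemma disc_nz: "disc \<noteq> 0" and degree_disc: "degree disc = 6"
  by (simp_all add: disc_explicit)

text \<open>The cofactors come from the extended Euclidean algorithm.\<close>

lemma disc_simple_root:
  assumes "poly disc c = 0"
  shows "poly (pderiv disc) c \<noteq> 0"
proof
  assume d: "poly (pderiv disc) c = 0"
  let ?p = "[:- 3096718750014, - 949868188658, 212191831348, 19672839828, - 5129493960:]"
  let ?q = "[:- 3129487739028, 735093931515, 254859330202, - 45837207089, - 3706264468, 854915660:]"
  have "?p * disc + ?q * pderiv disc = [:- 16779697250494464:]"
    by (simp add: disc_explicit pderiv_pCons)
  from arg_cong[OF this, of "\<lambda>p. poly p c"] show False using assms d by simp
qed

text \<open>A double root would also be a root of the derivative, against
  \<open>disc_simple_root\<close>.\<close>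

lemma disc_not_square_dvd: "\<not> [:- c, 1:] * [:- c, 1:] dvd disc"
proof
  assume "[:- c, 1:] * [:- c, 1:] dvd disc"
  then obtain q where "disc = [:- c, 1:] * [:- c, 1:] * q" by (rule dvdE)
  then have q: "disc = [:- c, 1:] * ([:- c, 1:] * q)" by (simp only: mult.assoc)
  have d: "pderiv disc = [:- c, 1:] * pderiv ([:- c, 1:] * q) + [:- c, 1:] * q * pderiv [:- c, 1:]"
    by (rule trans[OF arg_cong[OF q, of pderiv] pderiv_mult])
  have "poly disc c = 0" by (subst q) simp
  moreover have "poly (pderiv disc) c = 0" by (subst d) simp
  ultimately show False using disc_simple_root by blast
qed

text \<open>Completing the square: \<open>Z = 2 y + h\<close> turns the curve into
  \<open>Z^2 = disc\<close>, so a square root of \<open>disc\<close> yields a Laurent point.\<close>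

lemma laurent_point_of_sqrt:
  fixes u Z :: "qbar fls"
  assumes "Z * Z = fls.ev u disc"
  defines "y \<equiv> (Z - fls.ev u h_C) / 2"
  shows "y * y + fls.ev u h_C * y = fls.ev u f_C"
proof -
  have "4 * (y * y + fls.ev u h_C * y) = Z * Z - fls.ev u h_C * fls.ev u h_C"
    by (simp add: y_def field_simps)
  also have "\<dots> = 4 * fls.ev u f_C"
    by (simp add: assms(1) disc_def fls.hom_numeral)
  finally show ?thesis by (simp only: mult_cancel_left) simp
qed

text \<open>Where \<open>disc\<close> does not vanish it is a unit and has a square root. At a
  branch point it vanishes simply, and it becomes a square once \<open>x - c\<close> is the square
  of a parameter.\<close>

lemma place_over_point: "\<exists>v. place v \<and> v (xx - cst c) > 0"
proof -
  have c: "xx - cst c = cst.ev xx [:- c, 1:]" by (simp add: cst.hom_minus cst.hom_one)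
  have evc: "fls.ev u [:- c, 1:] = u - fls_const c" for u
    by (simp add: fls.hom_minus)
  have transc: "fls.ev u p \<noteq> 0" if "fls_subdegree (u - fls_const c) > 0" "p \<noteq> 0" for u and p :: "qbar poly"
  proof (rule fls.ev_ne_0[OF _ _ that(2), of u c])
    show "fls.vge 1 (u - fls_const c)" using that(1) by (simp add: fls.vge_def)
    show "u \<noteq> fls_const c" using that(1) by auto
  qed
  show ?thesis
  proof (cases "poly disc c = 0")
    case False
    define u where "u = fls_const c + fls_X"
    have u: "fls_subdegree (u - fls_const c) = 1" by (simp add: u_def)
    have "fls.ev u disc \<noteq> 0" "fls_subdegree (fls.ev u disc) = 0"
      using fls.ev_unit[of u c disc] False u by (simp_all add: fls.vge_def)
    then obtain Z where Z: "Z * Z = fls.ev u disc" using fls_sqrt by fastforce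
    have "\<exists>v. place v \<and> (\<forall>p. p \<noteq> 0 \<longrightarrow> v (cst.ev xx p) = fls_subdegree (fls.ev u p))"
      by (rule place_of_laurent_point[OF laurent_point_of_sqrt[OF Z], of "[:- c, 1:]" 0])
        (use u transc in \<open>simp_all add: evc del: fls.ev_pCons\<close>)
    then show ?thesis unfolding c using u evc[of u] by (force simp del: cst.ev_pCons fls.ev_pCons)
  next
    case True
    define u where "u = fls_const c + fls_X ^ 2"
    have u: "fls_subdegree (u - fls_const c) = 2" by (simp add: u_def)
    obtain e where e: "disc = [:- c, 1:] * e" using True poly_eq_0_iff_dvd by blast
    have "poly e c \<noteq> 0"
    proof
      assume "poly e c = 0"
      then have "[:- c, 1:] dvd e" by (simp add: poly_eq_0_iff_dvd)
      then show False using disc_not_square_dvd[of c] by (metis e mult_dvd_mono dvd_refl)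
    qed
    then have ev_e: "fls.ev u e \<noteq> 0" "fls_subdegree (fls.ev u e) = 0"
      using fls.ev_unit[of u c e] u by (simp_all add: fls.vge_def)
    then obtain R where R: "R * R = fls.ev u e" using fls_sqrt by fastforce
    define Z where "Z = fls_X * R"
    have "Z * Z = fls_X ^ 2 * (R * R)" by (simp only: Z_def power2_eq_square ac_simps)
    also have "\<dots> = fls.ev u [:- c, 1:] * fls.ev u e"
      unfolding evc R by (simp only: u_def add_diff_cancel_left')
    finally have "Z * Z = fls.ev u [:- c, 1:] * fls.ev u e" .
    then have Z: "Z * Z = fls.ev u disc" by (simp only: e fls.ev_mult)
    have "R \<noteq> 0" using R ev_e by auto
    moreover from this have "2 * fls_subdegree R = 0" using arg_cong[OF R, of fls_subdegree] ev_e by simp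
    ultimately have "fls_subdegree Z = 1" by (simp add: Z_def)
    \<comment> \<open>Since \<open>x - c\<close> has order \<open>2\<close> here, the function of
      order \<open>1\<close> is taken to be \<open>h + 2 y = Z\<close>.\<close>
    moreover have "fls.ev u h_C + fls.ev u [:2:] * ((Z - fls.ev u h_C) / 2) = Z"
    proof -
      have "2 * (W / 2) = W" for W :: "qbar fls" by simp
      then show ?thesis by (simp only: fls.ev_pCons fls.ev_0 fls.hom_numeral mult_zero_right add_0_right) simp
    qed
    ultimately have "\<exists>v. place v \<and> (\<forall>p. p \<noteq> 0 \<longrightarrow> v (cst.ev xx p) = fls_subdegree (fls.ev u p))"
      by (intro place_of_laurent_point[OF laurent_point_of_sqrt[OF Z], of h_C "[:2:]"])
        (use u transc in \<open>simp_all del: fls.ev_pCons\<close>)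
    then show ?thesis unfolding c using u evc[of u] by (force simp del: cst.ev_pCons fls.ev_pCons)
  qed
qed

text \<open>With \<open>x\<close> the inverse of the variable, \<open>disc\<close> has order
  \<open>- 6\<close>, which is even, so it has a square root.\<close>

lemma place_at_infinity: "\<exists>v. place v \<and> v xx < 0"
proof -
  define u :: "qbar fls" where "u = fls_X_inv"
  have u: "u \<noteq> 0" "fls_subdegree u < 0" by (simp_all add: u_def)
  note inf = fls.ev_infinite[OF u]
  have "fls.ev u disc \<noteq> 0" "fls_subdegree (fls.ev u disc) = - 6"
    using inf[OF disc_nz] by (simp_all add: degree_disc u_def)
  then obtain Z where Z: "Z * Z = fls.ev u disc" using fls_sqrt[of "fls.ev u disc"] by fastforce
  have "\<exists>v. place v \<and> (\<forall>p. p \<noteq> 0 \<longrightarrow> v (cst.ev xx p) = fls_subdegree (fls.ev u p))"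
    by (rule place_of_laurent_point[OF laurent_point_of_sqrt[OF Z], of "[:0, 1:]" 0])
      (use inf in \<open>simp_all add: u_def\<close>)
  then obtain v where v: "place v"
    and ev: "\<And>p. p \<noteq> 0 \<Longrightarrow> v (cst.ev xx p) = fls_subdegree (fls.ev u p)" by blast
  have "v xx < 0" using ev[of "[:0, 1:]"] by (simp add: u_def cst.hom_one)
  with v show ?thesis by blast
qed


subsection \<open>Functions with poles only at infinity\<close>

definition finite_place :: "(ff \<Rightarrow> int) \<Rightarrow> bool" where
  "finite_place v \<longleftrightarrow> place v \<and> valued_field.vge v 0 xx"

lemma finite_place_over_point: "\<exists>v. finite_place v \<and> v (xx - cst c) > 0"
proof -
  obtain v where v: "place v" "v (xx - cst c) > 0" using place_over_point by blast
  interpret valued_field cst v by (rule place_valued[OF v(1)])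
  have "vge 0 xx"
    using vge_add[OF _ vge_const[of 0 c], of "xx - cst c"] v(2) by (simp add: vge_def)
  then show ?thesis using v unfolding finite_place_def by blast
qed

lemma infinite_place: "place v \<Longrightarrow> \<not> finite_place v \<Longrightarrow> xx \<noteq> 0 \<and> v xx < 0"
  using valued_field.vge_def[OF place_valued] unfolding finite_place_def by fastforce

lemma finite_place_invol: "finite_place v \<Longrightarrow> finite_place (v \<circ> invol)"
  unfolding finite_place_def
  by (metis place_invol place_valued valued_field.vge_def invol_xx o_apply)

text \<open>In lowest terms, a root \<open>c\<close> of the denominator would give a pole at a place
  over \<open>c\<close>, and such a place exists.\<close>

lemma integral_poly:
  assumes "\<And>v. finite_place v \<Longrightarrow> valued_field.vge v 0 (Fn q 0)"
  shows "\<exists>p. q = Fract p 1"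
proof -
  obtain a b where ab: "q = Fract a b" "b \<noteq> 0" "coprime a b"
    using quot_of_fract_in_normalized_fracts[of q] Fract_quot_of_fract[of q]
    by (metis coprime_quot_of_fract snd_quot_of_fract_nonzero)
  have "degree b = 0"
  proof (rule ccontr)
    assume "degree b \<noteq> 0"
    then obtain c where c: "poly b c = 0" using alg_closed_imp_poly_has_root[of b] by auto
    have a: "poly a c \<noteq> 0"
      using c ab(3) coprime_common_divisor[of a b "[:- c, 1:]"]
      by (auto simp: poly_eq_0_iff_dvd is_unit_iff_degree)
    obtain v where v: "finite_place v" "v (xx - cst c) > 0" using finite_place_over_point by blast
    then interpret valued_field cst v by (simp add: finite_place_def place_valued)
    have 1: "vge 1 (xx - cst c)" using v(2) by (simp add: vge_def)
    obtain b' where b': "b = [:- c, 1:] * b'" using c poly_eq_0_iff_dvd by blast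
    have "vge 1 (cst.ev xx b)"
      using vge_mult[OF 1 vge_ev, of xx b'] v(1) unfolding b' finite_place_def
      by (simp add: ff_hom algebra_simps)
    moreover have "v (cst.ev xx a) = 0" by (rule ev_unit[OF 1 a])
    moreover have "a \<noteq> 0" using a by auto
    ultimately have "v (Fn q 0) < 0"
      using ab by (simp add: Fn_Fract v_divide vge_def)
    moreover have "Fn q 0 \<noteq> 0" using ab \<open>a \<noteq> 0\<close> by (simp add: Fn_Fract)
    ultimately show False using assms[OF v(1)] by (simp add: vge_def)
  qed
  then obtain d where "b = [:d:]" by (metis degree_eq_zeroE)
  then have "q = Fract (smult (inverse d) a) 1" using ab by (simp add: eq_fract)
  then show ?thesis by blast
qed

text \<open>In lowest terms the square of the denominator of \<open>q\<close> divides
  \<open>disc\<close>, which has no square factor, so the denominator is constant.\<close>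

lemma square_disc_poly:
  assumes "q * q * Fract disc 1 = Fract p 1"
  shows "\<exists>r. q = Fract r 1 \<and> p = r * r * disc"
proof -
  obtain a b where ab: "q = Fract a b" "b \<noteq> 0" "coprime a b"
    using quot_of_fract_in_normalized_fracts[of q] Fract_quot_of_fract[of q]
    by (metis coprime_quot_of_fract snd_quot_of_fract_nonzero)
  have eq: "a * a * disc = p * (b * b)" using assms ab by (simp add: eq_fract)
  have "coprime (b * b) (a * a)" using ab(3) by (simp add: coprime_commute)
  then have "b * b dvd disc"
    using eq by (metis coprime_dvd_mult_right_iff dvd_triv_right)
  have "degree b = 0"
  proof (rule ccontr)
    assume "degree b \<noteq> 0"
    then obtain c where c: "poly b c = 0" using alg_closed_imp_poly_has_root[of b] by auto
    then have "[:- c, 1:] * [:- c, 1:] dvd b * b" by (intro mult_dvd_mono) (simp_all add: poly_eq_0_iff_dvd)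
    then show False using \<open>b * b dvd disc\<close> disc_not_square_dvd dvd_trans by blast
  qed
  then obtain d where "b = [:d:]" by (metis degree_eq_zeroE)
  then have "q = Fract (smult (inverse d) a) 1" using ab by (simp add: eq_fract)
  moreover from this have "p = smult (inverse d) a * smult (inverse d) a * disc"
    using assms by (simp add: eq_fract del: mult_smult_left mult_smult_right)
  ultimately show ?thesis by blast
qed

text \<open>The Riemann-Roch space of twice the divisor at infinity consists of polynomials in \<open>x\<close>:
  a function \<open>a + b y\<close> with \<open>b \<noteq> 0\<close> satisfies \<open>(\<phi> - \<phi>')\<^sup>2 = b\<^sup>2 disc\<close>, where \<open>\<phi>'\<close> is its conjugate,
  and this has degree at least \<open>6\<close>.\<close>

lemma small_poles_imp_rational:
  assumes fin: "\<And>v. finite_place v \<Longrightarrow> valued_field.vge v 0 \<phi>"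
    and inf: "\<And>v. place v \<Longrightarrow> \<not> finite_place v \<Longrightarrow> valued_field.vge v (2 * v xx) \<phi>"
  shows "invol \<phi> = \<phi>"
proof -
  obtain a b where \<phi>: "\<phi> = Fn a b" by (cases \<phi>)
  define \<delta> where "\<delta> = \<phi> - invol \<phi>"
  have \<delta>2: "\<delta> * \<delta> = Fn (b * b * Fract disc 1) 0"
  proof -
    \<comment> \<open>Writing \<open>4\<close> as a sum leaves only sums and products under
      \<open>Fract\<close>, so the claim becomes a ring identity in \<open>H\<close> and
      \<open>F\<close>.\<close>
    have "smult (1 + 1 + 1 + 1) f_C = f_C + f_C + f_C + f_C"
      by (simp only: smult_add_left smult_1_left)
    then have 1: "disc = h_C * h_C + (f_C + f_C + f_C + f_C)" by (simp add: disc_def)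
    have 2: "Fract (r + s) 1 = Fract r 1 + Fract s 1" "Fract (r * s) 1 = Fract r 1 * Fract s 1"
      for r s :: "qbar poly" by simp_all
    define H where "H = Fract h_C 1"
    define F where "F = Fract f_C 1"
    have disc: "Fract disc 1 = H * H + (F + F + F + F)"
      unfolding 1 2 H_def F_def ..
    show ?thesis
      by (simp add: \<delta>_def \<phi> invol_def minus_ff_def uminus_ff_def Fn_times disc
          H_def[symmetric] F_def[symmetric] algebra_simps)
  qed
  have \<delta>: "valued_field.vge v n \<delta>"
    if v: "place v" and *: "valued_field.vge v n \<phi>" "valued_field.vge (v \<circ> invol) n \<phi>" for v n
  proof -
    interpret valued_field cst v by (rule place_valued[OF v])
    interpret i: valued_field cst "v \<circ> invol" by (rule place_valued[OF place_invol[OF v]])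
    have "vge n (invol \<phi>)" using *(2) by (simp add: vge_def i.vge_def)
    with *(1) show ?thesis unfolding \<delta>_def by (rule vge_diff)
  qed
  have "valued_field.vge v 0 (\<delta> * \<delta>)" if v: "finite_place v" for v
  proof -
    have p: "place v" using v by (simp add: finite_place_def)
    interpret valued_field cst v by (rule place_valued[OF p])
    have "vge 0 \<delta>" by (rule \<delta>[OF p fin[OF v] fin[OF finite_place_invol[OF v]]])
    then show ?thesis using vge_mult[of 0 \<delta> 0 \<delta>] by simp
  qed
  then obtain p where p: "b * b * Fract disc 1 = Fract p 1"
    unfolding \<delta>2 using integral_poly by blast
  then obtain r where r: "b = Fract r 1" "p = r * r * disc" using square_disc_poly by blast
  have "r = 0"
  proof (rule ccontr)
    assume nz: "r \<noteq> 0"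
    obtain v where v: "place v" "v xx < 0" using place_at_infinity by blast
    interpret valued_field cst v by (rule place_valued[OF v(1)])
    interpret i: valued_field cst "v \<circ> invol" by (rule place_valued[OF place_invol[OF v(1)]])
    have x0: "xx \<noteq> 0" using v place_0 by force
    have nf: "\<not> finite_place v" "\<not> finite_place (v \<circ> invol)"
      using v x0 by (auto simp: finite_place_def vge_def i.vge_def)
    have "vge (2 * v xx) \<delta>"
      by (rule \<delta>[OF v(1) inf[OF v(1) nf(1)]])
        (use inf[OF place_invol[OF v(1)] nf(2)] in simp)
    \<comment> \<open>The pole bound allows the polynomial \<open>\<delta> * \<delta>\<close> degree
      at most \<open>4\<close>, while its factor \<open>disc\<close> forces at least
      \<open>6\<close>.\<close>
    then have "vge (4 * v xx) (\<delta> * \<delta>)" using vge_mult by fastforce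
    moreover have "\<delta> * \<delta> = cst.ev xx p" by (simp add: \<delta>2 p ev_xx)
    moreover have "p \<noteq> 0" "degree p \<ge> 6" using nz by (simp_all add: r(2) disc_nz degree_mult_eq degree_disc)
    ultimately have "4 * v xx \<le> int (degree p) * v xx"
      using ev_infinite[OF x0 v(2) \<open>p \<noteq> 0\<close>] by (auto simp: vge_def)
    moreover have "int (degree p) * v xx \<le> 6 * v xx"
      using \<open>degree p \<ge> 6\<close> v(2) by (intro mult_right_mono_neg) simp_all
    ultimately show False using v(2) by simp
  qed
  then show ?thesis by (simp add: \<phi> r(1) flip: Zero_fract_def)
qed

section \<open>Divisors of functions\<close>

definition centred :: "(ff \<Rightarrow> int) \<Rightarrow> qbar \<Rightarrow> qbar \<Rightarrow> bool" where
  "centred v c d \<longleftrightarrow> place v \<and> valued_field.vge v 1 (xx - cst c) \<and> valued_field.vge v 1 (yy - cst d)"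

text \<open>The second condition says that the point is not fixed by the involution, i.e. that
  \<open>x\<close> is unramified there.\<close>

definition on_curve :: "qbar \<Rightarrow> qbar \<Rightarrow> bool" where
  "on_curve c d \<longleftrightarrow> d * d + poly h_C c * d = poly f_C c \<and> 2 * d + poly h_C c \<noteq> 0"

lemma xx_ne_cst: "xx \<noteq> cst c"
proof
  assume "xx = cst c"
  then have "cst.ev xx [:- c, 1:] = 0" by (simp add: ff_hom)
  then show False by (simp del: cst.ev_pCons)
qed

text \<open>An unramified point carries only one place. This makes the choice of \<open>vA\<close>
  and \<open>vB\<close> harmless and later forces their Galois invariance.\<close>

lemma centred_unique:
  assumes "centred v c d" "centred w c d" "on_curve c d"
  shows "v = w" "v (xx - cst c) = 1"
proof -
  have v: "place v" and w: "place w" using assms by (simp_all add: centred_def)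
  interpret valued_field cst v by (rule place_valued[OF v])
  obtain s where s: "s \<noteq> 0" "v s = 1" using v by (auto simp: place_def)
  obtain t where t: "t \<noteq> 0" "w t = 1" using w by (auto simp: place_def)
  note * = place_at_unramified_point[OF place_valued[OF w] curve ff_repr, of d c s t]
  show "v (xx - cst c) = 1"
    by (rule *(1)) (use assms s t xx_ne_cst in \<open>auto simp: centred_def on_curve_def\<close>)
  have "v \<phi> = w \<phi>" if "\<phi> \<noteq> 0" for \<phi>
    by (rule *(2)) (use assms s t xx_ne_cst that in \<open>auto simp: centred_def on_curve_def\<close>)
  then show "v = w" using place_0[OF v] place_0[OF w] by (metis ext)
qed

text \<open>\<open>y\<close> is integral over the polynomials in \<open>x\<close>: at a pole of
  \<open>y\<close>, its square would have twice the pole order, but \<open>f - h y\<close> has at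
  most that of \<open>y\<close>.\<close>

lemma vge_yy:
  assumes "finite_place v"
  shows "valued_field.vge v 0 yy"
proof -
  have v: "place v" "valued_field.vge v 0 xx" using assms by (simp_all add: finite_place_def)
  interpret valued_field cst v by (rule place_valued[OF v(1)])
  show ?thesis
  proof (rule ccontr)
    assume "\<not> vge 0 yy"
    then have y: "yy \<noteq> 0" "v yy < 0" by (simp_all add: vge_def)
    have "vge (v yy) (cst.ev xx f_C - cst.ev xx h_C * yy)"
    proof (rule vge_diff)
      show "vge (v yy) (cst.ev xx f_C)" using vge_mono[OF vge_ev[OF v(2)], of "v yy"] y by simp
      show "vge (v yy) (cst.ev xx h_C * yy)"
        using vge_mult[OF vge_ev[OF v(2)], of "v yy" yy h_C] y by (simp add: vge_def)
    qed
    also have "cst.ev xx f_C - cst.ev xx h_C * yy = yy * yy" using curve by (simp add: algebra_simps)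
    finally show False using y by (simp add: vge_def v_mult)
  qed
qed

lemma invol_yy: "invol yy = - cst.ev xx h_C - yy"
  by (simp add: invol_def yy_def ev_xx minus_ff_def uminus_ff_def)

text \<open>The product of \<open>y - d\<close> and its conjugate is a multiple of
  \<open>x - c\<close>. Both factors are regular, so one of them vanishes at the place.\<close>

lemma centred_cases:
  assumes v: "finite_place v" "v (xx - cst c) > 0" and "on_curve c d"
  shows "centred v c d \<or> centred (v \<circ> invol) c d"
proof -
  have p: "place v" using v by (simp add: finite_place_def)
  interpret valued_field cst v by (rule place_valued[OF p])
  interpret i: valued_field cst "v \<circ> invol" by (rule place_valued[OF place_invol[OF p]])
  have x: "vge 1 (xx - cst c)" "i.vge 1 (xx - cst c)"
    using v(2) by (simp_all add: vge_def i.vge_def invol_diff)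
  have "poly (f_C - smult d h_C - [:d * d:]) c = 0"
    using assms(3) by (simp add: on_curve_def algebra_simps)
  then obtain g where g: "f_C - smult d h_C - [:d * d:] = [:- c, 1:] * g"
    using poly_eq_0_iff_dvd by blast
  have "(yy - cst d) * invol (yy - cst d) =
      cst d * cst.ev xx h_C + cst d * cst d - (yy * yy + cst.ev xx h_C * yy)"
    by (simp add: invol_diff invol_yy algebra_simps)
  also have "\<dots> = - ((xx - cst c) * cst.ev xx g)"
    unfolding curve using arg_cong[OF g, of "cst.ev xx"] by (simp add: ff_hom algebra_simps)
  finally have "vge 1 ((yy - cst d) * invol (yy - cst d))"
    using vge_mult[OF x(1) vge_ev, of xx g] v(1) by (simp add: finite_place_def)
  moreover have "vge 0 (yy - cst d)" "vge 0 (invol (yy - cst d))"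
  proof -
    show "vge 0 (yy - cst d)" using vge_yy[OF v(1)] by (simp add: vge_diff)
    have "i.vge 0 (yy - cst d)"
      using vge_yy[OF finite_place_invol[OF v(1)]] by (simp add: i.vge_diff)
    then show "vge 0 (invol (yy - cst d))" by (simp add: vge_def i.vge_def)
  qed
  ultimately have "vge 1 (yy - cst d) \<or> vge 1 (invol (yy - cst d))"
    by (auto simp: vge_def v_mult)
  then show ?thesis
    using p place_invol[OF p] x by (auto simp: centred_def vge_def i.vge_def)
qed

lemma centred_exists:
  assumes "on_curve c d"
  shows "\<exists>v. centred v c d"
  using finite_place_over_point[of c] centred_cases[OF _ _ assms] by blast

lemma centred_finite: "centred v c d \<Longrightarrow> finite_place v"
proof -
  assume v: "centred v c d"
  then interpret valued_field cst v by (simp add: centred_def place_valued)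
  have "vge 0 xx"
    using v vge_add[OF vge_mono vge_const[of 0 c], of 1 "xx - cst c"] by (simp add: centred_def)
  with v show ?thesis by (simp add: centred_def finite_place_def)
qed

section \<open>Norms of the functions \<open>a + b y\<close>\<close>

definition fn :: "qbar poly \<Rightarrow> qbar poly \<Rightarrow> ff" where
  "fn a b = cst.ev xx a + cst.ev xx b * yy"

lemma fn_Fn: "fn a b = Fn (Fract a 1) (Fract b 1)"
  by (simp add: fn_def ev_xx yy_def Fn_times)

lemma fn_nz [simp]: "fn a b = 0 \<longleftrightarrow> a = 0 \<and> b = 0"
  by (simp add: fn_Fn zero_ff_def eq_fract Zero_fract_def)

lemma invol_fn: "invol (fn a b) = fn (a - b * h_C) (- b)"
  by (simp add: fn_Fn invol_def)

lemma fn_norm: "fn a b * invol (fn a b) = cst.ev xx (a * a - a * b * h_C - b * b * f_C)"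
proof -
  have i: "invol (fn a b) = cst.ev xx a - cst.ev xx b * cst.ev xx h_C - cst.ev xx b * yy"
    unfolding invol_fn by (simp add: fn_def)
  have "fn a b * invol (fn a b) = cst.ev xx a * cst.ev xx a - cst.ev xx a * cst.ev xx b * cst.ev xx h_C
      - cst.ev xx b * cst.ev xx b * (yy * yy + cst.ev xx h_C * yy)"
    unfolding i by (simp add: fn_def algebra_simps)
  then show ?thesis unfolding curve by simp
qed

text \<open>The hypothesis concerns the value of the function at the point: replacing
  \<open>y\<close> by \<open>d\<close> changes the function by a term of positive order.\<close>

lemma centred_unit:
  assumes v: "centred v c d" and nz: "poly a c + poly b c * d \<noteq> 0"
  shows "v (fn a b) = 0"
proof -
  interpret valued_field cst v using v by (simp add: centred_def place_valued)
  have x: "vge 1 (xx - cst c)" "vge 0 xx" and y: "vge 1 (yy - cst d)"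
    using v centred_finite[OF v] by (simp_all add: centred_def finite_place_def)
  have "fn a b = cst.ev xx (a + smult d b) + cst.ev xx b * (yy - cst d)"
    by (simp add: fn_def algebra_simps)
  moreover have "poly (a + smult d b) c \<noteq> 0" using nz by (simp add: mult.commute)
  then have "cst.ev xx (a + smult d b) \<noteq> 0 \<and> v (cst.ev xx (a + smult d b)) = 0"
    using ev_unit[OF x(1)] by blast
  moreover have "vge 1 (cst.ev xx b * (yy - cst d))"
    using vge_mult[OF vge_ev[OF x(2)] y] by simp
  ultimately show ?thesis
    using v_add_dominant(2)[of "cst.ev xx (a + smult d b)" "cst.ev xx b * (yy - cst d)"] by simp
qed

text \<open>For a norm supported over \<open>x = 2\<close> and \<open>x = 4\<close>, this yields the
  order of the conjugate function from that of the function itself.\<close>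

lemma norm_valuation:
  assumes "place v" "a \<noteq> 0 \<or> b \<noteq> 0"
    and "a * a - a * b * h_C - b * b * f_C = smult k ([:- 2, 1:] ^ i * [:- 4, 1:] ^ j)" "k \<noteq> 0"
  shows "v (fn a b) + v (invol (fn a b)) = int i * v (xx - 2) + int j * v (xx - 4)"
proof -
  interpret valued_field cst v by (rule place_valued[OF assms(1)])
  have nz: "xx - 2 \<noteq> 0" "xx - 4 \<noteq> 0"
    using xx_ne_cst[of 2] xx_ne_cst[of 4] by (simp_all add: ff_hom)
  have "v (fn a b * invol (fn a b)) = int i * v (xx - 2) + int j * v (xx - 4)"
    unfolding fn_norm assms(3) using nz assms(4)
    by (simp add: ff_hom v_mult v_power v_const)
  then show ?thesis using assms(2) by (simp add: v_mult)
qed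

text \<open>Write \<open>A = (2, 17)\<close>, \<open>B = (4, 23)\<close>, \<open>A'\<close>, \<open>B'\<close> for their conjugates, and \<open>P\<close>, \<open>Q\<close> for the points
  at infinity where \<open>y\<close> is finite and infinite. The divisors of the functions below are
  \<open>4 A' + B' - 2 P - 3 Q\<close>, \<open>2 A + 6 B' - 4 P - 4 Q\<close> and \<open>5 B - 5 Q\<close>; the coefficients are found by
  linear algebra from these vanishing conditions.\<close>

definition a1 :: "qbar poly" where "a1 = [:121, - 54, 9:]"
definition a2 :: "qbar poly" where "a2 = [:10320, - 13804, 6776, - 1452, 121:]"
definition b2 :: "qbar poly" where "b2 = [:- 48, 20:]"
definition a3 :: "qbar poly" where "a3 = [:- 396, 57, - 1:]"
definition b3 :: "qbar poly" where "b3 = [:36, - 15, 2:]"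

definition \<phi>1 :: ff where "\<phi>1 = fn a1 1"
definition \<phi>2 :: ff where "\<phi>2 = fn a2 b2"
definition \<phi>3 :: ff where "\<phi>3 = fn a3 b3"

lemmas ab_defs = a1_def a2_def b2_def a3_def b3_def

lemma \<phi>_nz [simp]: "\<phi>1 \<noteq> 0" "\<phi>2 \<noteq> 0" "\<phi>3 \<noteq> 0"
  by (simp_all add: \<phi>1_def \<phi>2_def \<phi>3_def ab_defs)

lemma xx_ne [simp]: "xx \<noteq> 2" "xx \<noteq> 4"
  using xx_ne_cst[of 2] xx_ne_cst[of 4] by (simp_all add: ff_hom)

lemma norms:
  assumes "place v"
  shows "v \<phi>1 + v (invol \<phi>1) = 4 * v (xx - 2) + v (xx - 4)"
    and "v \<phi>2 + v (invol \<phi>2) = 2 * v (xx - 2) + 6 * v (xx - 4)"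
    and "v \<phi>3 + v (invol \<phi>3) = 5 * v (xx - 4)"
proof -
  have "a1 * a1 - a1 * 1 * h_C - 1 * 1 * f_C = smult (- 18) ([:- 2, 1:] ^ 4 * [:- 4, 1:] ^ 1)"
    by (simp add: ab_defs h_C_def f_C_def power_numeral_reduce)
  from norm_valuation[OF assms _ this] show "v \<phi>1 + v (invol \<phi>1) = 4 * v (xx - 2) + v (xx - 4)"
    by (simp add: \<phi>1_def)
  have "a2 * a2 - a2 * b2 * h_C - b2 * b2 * f_C = smult 9801 ([:- 2, 1:] ^ 2 * [:- 4, 1:] ^ 6)"
    by (simp add: ab_defs h_C_def f_C_def power_numeral_reduce)
  from norm_valuation[OF assms _ this] show "v \<phi>2 + v (invol \<phi>2) = 2 * v (xx - 2) + 6 * v (xx - 4)"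
    by (simp add: \<phi>2_def ab_defs)
  have "a3 * a3 - a3 * b3 * h_C - b3 * b3 * f_C = smult (- 1458) ([:- 2, 1:] ^ 0 * [:- 4, 1:] ^ 5)"
    by (simp add: ab_defs h_C_def f_C_def power_numeral_reduce)
  from norm_valuation[OF assms _ this] show "v \<phi>3 + v (invol \<phi>3) = 5 * v (xx - 4)"
    by (simp add: \<phi>3_def ab_defs)
qed

section \<open>The places at \<open>A\<close> and \<open>B\<close>\<close>

lemma on_curve_A: "on_curve 2 17" and on_curve_B: "on_curve 4 23"
  by (simp_all add: on_curve_def h_C_def f_C_def)

definition vA :: "ff \<Rightarrow> int" where "vA = (SOME v. centred v 2 17)"
definition vB :: "ff \<Rightarrow> int" where "vB = (SOME v. centred v 4 23)"

lemma centred_vA: "centred vA 2 17" and centred_vB: "centred vB 4 23"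
  unfolding vA_def vB_def using centred_exists[OF on_curve_A] centred_exists[OF on_curve_B]
  by (metis someI)+

lemma place_vA: "place vA" and place_vB: "place vB"
  using centred_vA centred_vB by (simp_all add: centred_def)

lemma v_linear:
  assumes "finite_place v" "v (xx - cst c) > 0" "c \<noteq> c'"
  shows "v (xx - cst c') = 0"
proof -
  interpret valued_field cst v using assms by (simp add: finite_place_def place_valued)
  have "vge 1 (xx - cst c)" using assms(2) by (simp add: vge_def)
  from ev_unit(2)[OF this, of "[:- c', 1:]"] show ?thesis using assms(3) by (simp add: ff_hom)
qed

text \<open>In each conjugate pair one function does not vanish at the point and so has order
  \<open>0\<close>; the norm then gives the order of the other. \<open>values_B\<close> is obtained
  in the same way.\<close>

lemma values_A:
  "vA (xx - 2) = 1" "vA (xx - 4) = 0"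
  "vA \<phi>1 = 0" "vA (invol \<phi>1) = 4" "vA \<phi>2 = 2" "vA (invol \<phi>2) = 0" "vA \<phi>3 = 0" "vA (invol \<phi>3) = 0"
proof -
  note c = centred_vA
  show x: "vA (xx - 2) = 1"
    using centred_unique(2)[OF c c on_curve_A] by (simp add: ff_hom)
  show x4: "vA (xx - 4) = 0"
    using v_linear[OF centred_finite[OF c], of 2 4] x by (simp add: ff_hom)
  show 1: "vA \<phi>1 = 0" unfolding \<phi>1_def by (rule centred_unit[OF c]) (simp add: ab_defs)
  show 2: "vA (invol \<phi>2) = 0"
    unfolding \<phi>2_def invol_fn by (rule centred_unit[OF c]) (simp add: ab_defs h_C_def)
  show 3: "vA \<phi>3 = 0" unfolding \<phi>3_def by (rule centred_unit[OF c]) (simp add: ab_defs)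
  show "vA (invol \<phi>1) = 4" "vA \<phi>2 = 2" "vA (invol \<phi>3) = 0"
    using norms[OF place_vA] x x4 1 2 3 by simp_all
qed

lemma values_B:
  "vB (xx - 2) = 0" "vB (xx - 4) = 1"
  "vB \<phi>1 = 0" "vB (invol \<phi>1) = 1" "vB \<phi>2 = 0" "vB (invol \<phi>2) = 6" "vB \<phi>3 = 5" "vB (invol \<phi>3) = 0"
proof -
  note c = centred_vB
  show x: "vB (xx - 4) = 1"
    using centred_unique(2)[OF c c on_curve_B] by (simp add: ff_hom)
  show x2: "vB (xx - 2) = 0"
    using v_linear[OF centred_finite[OF c], of 4 2] x by (simp add: ff_hom)
  show 1: "vB \<phi>1 = 0" unfolding \<phi>1_def by (rule centred_unit[OF c]) (simp add: ab_defs)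
  show 2: "vB \<phi>2 = 0" unfolding \<phi>2_def by (rule centred_unit[OF c]) (simp add: ab_defs)
  show 3: "vB (invol \<phi>3) = 0"
    unfolding \<phi>3_def invol_fn by (rule centred_unit[OF c]) (simp add: ab_defs h_C_def)
  show "vB (invol \<phi>1) = 1" "vB (invol \<phi>2) = 6" "vB \<phi>3 = 5"
    using norms[OF place_vB] x x2 1 2 3 by simp_all
qed

text \<open>Over \<open>x = 2\<close> and \<open>x = 4\<close> only the four known places occur.
  Elsewhere the norms have order \<open>0\<close>, and as both conjugates are regular, each has
  order \<open>0\<close>.\<close>

lemma finite_place_cases:
  assumes "finite_place v"
  obtains "v = vA" | "v = vA \<circ> invol" | "v = vB" | "v = vB \<circ> invol"
    | "v (xx - 2) = 0" "v (xx - 4) = 0" "v \<phi>1 = 0" "v \<phi>2 = 0" "v \<phi>3 = 0"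
proof -
  have p: "place v" using assms by (simp add: finite_place_def)
  interpret valued_field cst v by (rule place_valued[OF p])
  interpret i: valued_field cst "v \<circ> invol" by (rule place_valued[OF place_invol[OF p]])
  have flip: "v = w \<circ> invol" if "v \<circ> invol = w" for w
    using that by (auto simp: fun_eq_iff) (metis invol_invol)
  have int: "vge 0 (fn a b)" "vge 0 (invol (fn a b))" for a b
  proof -
    have "vge 0 (fn a b)" for a b
      using assms vge_mult[OF vge_ev vge_yy[OF assms], of xx b]
      unfolding fn_def finite_place_def by (intro vge_add vge_ev) simp_all
    then show "vge 0 (fn a b)" "vge 0 (invol (fn a b))" by (simp_all add: invol_fn)
  qed
  have x: "vge 0 (xx - 2)" "vge 0 (xx - 4)"
    using assms by (simp_all add: finite_place_def vge_diff)
  then have "v (xx - 2) \<ge> 0" "v (xx - 4) \<ge> 0" by (simp_all add: vge_def)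
  then consider "v (xx - 2) > 0" | "v (xx - 4) > 0" | "v (xx - 2) = 0" "v (xx - 4) = 0"
    by linarith
  then show thesis
  proof cases
    case 1
    then have "centred v 2 17 \<or> centred (v \<circ> invol) 2 17"
      using centred_cases[OF assms _ on_curve_A] by (simp add: ff_hom)
    then show thesis
      using centred_unique(1)[OF _ centred_vA on_curve_A] flip that(1,2) by metis
  next
    case 2
    then have "centred v 4 23 \<or> centred (v \<circ> invol) 4 23"
      using centred_cases[OF assms _ on_curve_B] by (simp add: ff_hom)
    then show thesis
      using centred_unique(1)[OF _ centred_vB on_curve_B] flip that(3,4) by metis
  next
    case 3
    have "v \<phi>1 \<ge> 0" "v (invol \<phi>1) \<ge> 0" "v \<phi>2 \<ge> 0" "v (invol \<phi>2) \<ge> 0" "v \<phi>3 \<ge> 0" "v (invol \<phi>3) \<ge> 0"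
      using int[of a1 1] int[of a2 b2] int[of a3 b3]
      by (simp_all add: vge_def flip: \<phi>1_def \<phi>2_def \<phi>3_def)
    then show thesis using norms[OF p] 3 that(5) by simp
  qed
qed

section \<open>Orders at infinity\<close>

text \<open>This is the point \<open>P\<close>: \<open>y\<close> has order \<open>0\<close> and its
  conjugate has the order of \<open>h\<close>. One order in each pair is read off from leading
  terms, the other follows from the norm.\<close>

lemma values_infinite_aux:
  assumes p: "place v" and inf: "v xx < 0" and y: "v yy = 0"
  shows "v \<phi>1 = 2 * v xx" "v (invol \<phi>1) = 3 * v xx"
    "v \<phi>2 = 4 * v xx" "v (invol \<phi>2) = 4 * v xx" "v \<phi>3 = 0" "v (invol \<phi>3) = 5 * v xx"
proof -
  interpret valued_field cst v by (rule place_valued[OF p])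
  have x0: "xx \<noteq> 0" using inf place_0[OF p] by force
  have y0: "yy \<noteq> 0" by (simp add: yy_def zero_ff_def)
  note ev = ev_infinite[OF x0 inf]
  have x: "v (xx - 2) = v xx" "v (xx - 4) = v xx"
    using v_add_dominant(2)[OF x0, of "- 2"] v_add_dominant(2)[OF x0, of "- 4"] inf by simp_all
  have nz: "a1 \<noteq> 0" "a2 \<noteq> 0" "b2 \<noteq> 0" "a3 \<noteq> 0" "b3 \<noteq> 0" "h_C \<noteq> 0"
    and deg: "degree a1 = 2" "degree a2 = 4" "degree b2 = 1" "degree a3 = 2" "degree b3 = 2" "degree h_C = 3"
    by (simp_all add: ab_defs h_C_def)
  show 1: "v \<phi>1 = 2 * v xx"
    using v_add_dominant(2)[of "cst.ev xx a1" yy] ev[OF nz(1)] inf y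
    by (simp add: \<phi>1_def fn_def deg vge_def)
  have "vge (v (cst.ev xx a2) + 1) (cst.ev xx b2 * yy)"
    using ev[OF nz(2)] ev[OF nz(3)] inf y y0 by (simp add: deg vge_def v_mult)
  then show 2: "v \<phi>2 = 4 * v xx"
    using v_add_dominant(2)[of "cst.ev xx a2" "cst.ev xx b2 * yy"] ev[OF nz(2)]
    by (simp add: \<phi>2_def fn_def deg)
  have iy: "v (invol yy) = 3 * v xx"
    using v_add_dominant(2)[of "- cst.ev xx h_C" "- yy"] ev[OF nz(6)] inf y
    by (simp add: invol_yy deg vge_def)
  have iy0: "invol yy \<noteq> 0" using y0 by simp
  \<comment> \<open>In \<open>\<phi>3\<close> itself the terms \<open>a3\<close> and
    \<open>b3 y\<close> have equal order and cancel, so its conjugate is computed instead.\<close>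
  have prod: "cst.ev xx b3 * invol yy \<noteq> 0" "v (cst.ev xx b3 * invol yy) = 5 * v xx"
    using ev[OF nz(5)] iy iy0 by (simp_all add: v_mult deg)
  have "vge (5 * v xx + 1) (cst.ev xx a3)"
    using ev[OF nz(4)] inf by (simp add: deg vge_def)
  then have "v (cst.ev xx b3 * invol yy + cst.ev xx a3) = 5 * v xx"
    using v_add_dominant(2)[OF prod(1), of "cst.ev xx a3"] by (simp add: prod(2))
  moreover have "invol \<phi>3 = cst.ev xx b3 * invol yy + cst.ev xx a3"
    by (simp add: \<phi>3_def fn_def invol_add invol_mult add.commute)
  ultimately show 3: "v (invol \<phi>3) = 5 * v xx" by simp
  show "v (invol \<phi>1) = 3 * v xx" "v (invol \<phi>2) = 4 * v xx" "v \<phi>3 = 0"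
    using norms[OF p] 1 2 3 x by simp_all
qed

text \<open>\<open>y\<close> and its conjugate have product \<open>- f\<close> and sum
  \<open>- h\<close>, both of degree \<open>3\<close> in \<open>x\<close>, so one of them has order
  \<open>0\<close>. The two cases are \<open>P\<close> and \<open>Q\<close>.\<close>

lemma infinite_place_cases:
  assumes p: "place v" and inf: "\<not> finite_place v"
  obtains "v xx < 0" "v (xx - 2) = v xx" "v (xx - 4) = v xx"
      "v \<phi>1 = 2 * v xx" "v \<phi>2 = 4 * v xx" "v \<phi>3 = 0"
    | "v xx < 0" "v (xx - 2) = v xx" "v (xx - 4) = v xx"
      "v \<phi>1 = 3 * v xx" "v \<phi>2 = 4 * v xx" "v \<phi>3 = 5 * v xx"
proof -
  interpret valued_field cst v by (rule place_valued[OF p])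
  have x0: "xx \<noteq> 0" and neg: "v xx < 0" using infinite_place[OF assms] by simp_all
  have y0: "yy \<noteq> 0" "invol yy \<noteq> 0" by (simp_all add: yy_def zero_ff_def invol_def)
  note ev = ev_infinite[OF x0 neg]
  have x: "v (xx - 2) = v xx" "v (xx - 4) = v xx"
    using v_add_dominant(2)[OF x0, of "- 2"] v_add_dominant(2)[OF x0, of "- 4"] neg by simp_all
  have h: "cst.ev xx h_C \<noteq> 0" "v (cst.ev xx h_C) = 3 * v xx"
    and f: "cst.ev xx f_C \<noteq> 0" "v (cst.ev xx f_C) = 3 * v xx"
    using ev[of h_C] ev[of f_C] by (simp_all add: h_C_def f_C_def del: cst.ev_pCons)
  have "yy * invol yy = - cst.ev xx f_C"
    using curve by (simp add: invol_yy algebra_simps)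
  then have sum: "v yy + v (invol yy) = 3 * v xx"
    using v_mult[OF y0] f by simp
  have "v yy = 0 \<or> v (invol yy) = 0"
  proof (cases "v yy > 3 * v xx")
    case True
    then have "v (- cst.ev xx h_C + - yy) = 3 * v xx"
      using v_add_dominant(2)[of "- cst.ev xx h_C" "- yy"] h by (simp add: vge_def)
    then show ?thesis using sum by (simp add: invol_yy)
  next
    case False
    then have "v (invol yy) > 3 * v xx" using sum neg by linarith
    then have "v (- cst.ev xx h_C + - invol yy) = 3 * v xx"
      using v_add_dominant(2)[of "- cst.ev xx h_C" "- invol yy"] h by (simp add: vge_def)
    then show ?thesis using sum by (simp add: invol_yy)
  qed
  then show thesis
  proof
    assume "v yy = 0"
    from values_infinite_aux[OF p neg this] show thesis using that(1) neg x by simp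
  next
    assume "v (invol yy) = 0"
    then show thesis
      using values_infinite_aux[OF place_invol[OF p]] that(2) neg x by simp
  qed
qed


section \<open>Functions with divisor \<open>n (A - B)\<close>\<close>

definition has_divisor :: "ff \<Rightarrow> int \<Rightarrow> bool" where
  "has_divisor \<psi> n \<longleftrightarrow> \<psi> \<noteq> 0 \<and> (\<forall>v. place v \<longrightarrow>
     v \<psi> = (if v = vA then n else 0) - (if v = vB then n else 0))"

lemma v_monomial:
  assumes "place v" "\<psi> \<noteq> 0"
  shows "v (\<psi> powi l * \<phi>1 powi i * \<phi>2 powi j * \<phi>3 powi k * (xx - 2) powi m * (xx - 4) powi n) =
    l * v \<psi> + i * v \<phi>1 + j * v \<phi>2 + k * v \<phi>3 + m * v (xx - 2) + n * v (xx - 4)"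
proof -
  interpret valued_field cst v by (rule place_valued[OF assms(1)])
  show ?thesis using assms(2) by (simp add: v_mult v_power_int)
qed

lemma distinct_places:
  "vA \<noteq> vB" "vA \<circ> invol \<noteq> vA" "vA \<circ> invol \<noteq> vB" "vB \<circ> invol \<noteq> vA" "vB \<circ> invol \<noteq> vB"
proof -
  have "invol (xx - 2) = xx - 2" by (simp add: invol_diff)
  then show "vA \<noteq> vB" "vA \<circ> invol \<noteq> vA" "vA \<circ> invol \<noteq> vB" "vB \<circ> invol \<noteq> vA" "vB \<circ> invol \<noteq> vB"
    using values_A values_B by (metis o_apply zero_neq_one zero_neq_numeral)+
qed

lemma infinite_distinct:
  assumes "place v" "\<not> finite_place v"
  shows "v \<noteq> vA" "v \<noteq> vB"
  using assms centred_finite[OF centred_vA] centred_finite[OF centred_vB] by auto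

lemma has_divisor_70: "\<exists>\<psi>. has_divisor \<psi> 70"
proof (rule exI)
  \<comment> \<open>The exponents solve the linear system asking for order \<open>70\<close> at
    \<open>A\<close>, \<open>- 70\<close> at \<open>B\<close> and \<open>0\<close> at
    \<open>A'\<close>, \<open>B'\<close>, \<open>P\<close> and \<open>Q\<close>. The factor
    \<open>1 powi 0\<close> gives the product the shape of \<open>v_monomial\<close>.\<close>
  let ?\<psi> = "1 powi 0 * \<phi>1 powi (- 10) * \<phi>2 powi 15 * \<phi>3 powi 2 * (xx - 2) powi 40 * (xx - 4) powi (- 80)"
  show "has_divisor ?\<psi> 70"
    unfolding has_divisor_def
  proof (intro conjI allI impI)
    show "?\<psi> \<noteq> 0" by simp
    fix v assume v: "place v"
    have m: "v ?\<psi> = - 10 * v \<phi>1 + 15 * v \<phi>2 + 2 * v \<phi>3 + 40 * v (xx - 2) - 80 * v (xx - 4)"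
      using v_monomial[OF v one_neq_zero, of 0 "- 10" 15 2 40 "- 80"] by simp
    show "v ?\<psi> = (if v = vA then 70 else 0) - (if v = vB then 70 else 0)"
    proof (cases "finite_place v")
      case True
      then show ?thesis
      proof (cases rule: finite_place_cases)
        case 5
        then have "v \<noteq> vA" "v \<noteq> vB" using values_A values_B by auto
        with 5 show ?thesis unfolding m by simp
      qed (unfold m, simp_all add: values_A values_B distinct_places distinct_places(1)[symmetric] invol_diff)
    next
      case False
      note d = infinite_distinct[OF v False]
      from v False show ?thesis
        by (cases rule: infinite_place_cases) (unfold m, simp_all add: d)
    qed
  qed
qed

text \<open>A monomial in \<open>\<psi>\<close> and the functions with known divisors lying in the Riemann-Roch space of
  twice the divisor at infinity has equal orders at conjugate points.\<close>

lemma divisor_obstruction: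
  assumes \<psi>: "has_divisor \<psi> N"
    and A: "l * N + 2 * j + m = rA" "4 * i + m = rA'" "rA \<ge> 0" "rA' \<ge> 0"
    and B: "5 * k + n - l * N = rB" "i + 6 * j + n = rB'" "rB \<ge> 0" "rB' \<ge> 0"
    and inf: "2 * i + 4 * j + m + n \<le> 2" "3 * i + 4 * j + 5 * k + m + n \<le> 2"
  shows "rA = rA' \<and> rB = rB'"
proof -
  \<comment> \<open>The orders of \<open>\<theta>\<close> at \<open>A\<close>, \<open>A'\<close>,
    \<open>B\<close>, \<open>B'\<close> are \<open>rA\<close>, \<open>rA'\<close>,
    \<open>rB\<close>, \<open>rB'\<close>; the sums in \<open>inf\<close> are its orders at
    \<open>P\<close> and \<open>Q\<close> in multiples of \<open>v xx\<close>.\<close>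
  define \<theta> where "\<theta> = \<psi> powi l * \<phi>1 powi i * \<phi>2 powi j * \<phi>3 powi k * (xx - 2) powi m * (xx - 4) powi n"
  have nz: "\<psi> \<noteq> 0" using \<psi> by (simp add: has_divisor_def)
  have val: "v \<psi> = (if v = vA then N else 0) - (if v = vB then N else 0)" if "place v" for v
    using \<psi> that by (simp add: has_divisor_def)
  note mono = v_monomial[OF _ nz, of _ l i j k m n, folded \<theta>_def]
  have \<theta>A: "vA \<theta> = rA" "(vA \<circ> invol) \<theta> = rA'"
    using A mono[OF place_vA] mono[OF place_invol[OF place_vA]] values_A
      val[OF place_vA] val[OF place_invol[OF place_vA]] distinct_places
    by (simp_all add: invol_diff algebra_simps)
  have \<theta>B: "vB \<theta> = rB" "(vB \<circ> invol) \<theta> = rB'"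
    using B mono[OF place_vB] mono[OF place_invol[OF place_vB]] values_B
      val[OF place_vB] val[OF place_invol[OF place_vB]] distinct_places distinct_places(1)[symmetric]
    by (simp_all add: invol_diff algebra_simps)
  have "invol \<theta> = \<theta>"
  proof (rule small_poles_imp_rational)
    fix v assume v: "finite_place v"
    then have p: "place v" by (simp add: finite_place_def)
    from v have "v \<theta> \<ge> 0"
    proof (cases rule: finite_place_cases)
      case 5
      then have "v \<noteq> vA" "v \<noteq> vB" using values_A values_B by auto
      with 5 show ?thesis using mono[OF p] val[OF p] by simp
    qed (use \<theta>A \<theta>B A B in simp_all)
    then show "valued_field.vge v 0 \<theta>"
      by (simp add: valued_field.vge_def[OF place_valued[OF p]])
  next
    fix v assume v: "place v" "\<not> finite_place v"
    have \<psi>0: "v \<psi> = 0" using infinite_distinct[OF v] val[OF v(1)] by simp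
    from v have "v \<theta> \<ge> 2 * v xx"
    proof (cases rule: infinite_place_cases)
      case 1
      then have "v \<theta> = (2 * i + 4 * j + m + n) * v xx"
        using mono[OF v(1)] \<psi>0 by (simp add: algebra_simps)
      with 1 show ?thesis using inf(1) by (simp add: mult_right_mono_neg)
    next
      case 2
      then have "v \<theta> = (3 * i + 4 * j + 5 * k + m + n) * v xx"
        using mono[OF v(1)] \<psi>0 by (simp add: algebra_simps)
      with 2 show ?thesis using inf(2) by (simp add: mult_right_mono_neg)
    qed
    then show "valued_field.vge v (2 * v xx) \<theta>"
      by (simp add: valued_field.vge_def[OF place_valued[OF v(1)]])
  qed
  then show ?thesis using \<theta>A \<theta>B by simp
qed

text \<open>The exponents turn \<open>35 (A - B)\<close>, \<open>28 (A - B)\<close> and \<open>30 (A - B)\<close> into the equivalent divisors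
  \<open>A' + 3 B - 2 P - 2 Q\<close>, \<open>B' - P\<close> and \<open>3 B - 2 P - Q\<close>.\<close>

lemma not_has_divisor:
  "\<not> has_divisor \<psi> 35" "\<not> has_divisor \<psi> 14" "\<not> has_divisor \<psi> 10"
proof -
  \<comment> \<open>The contradictory orders are \<open>0\<close> and \<open>1\<close> at
    \<open>A\<close> and \<open>A'\<close> here, \<open>0\<close> and \<open>1\<close> at
    \<open>B\<close> and \<open>B'\<close> for \<open>14\<close>, and \<open>3\<close> and
    \<open>0\<close> at \<open>B\<close> and \<open>B'\<close> for \<open>10\<close>.\<close>
  show "\<not> has_divisor \<psi> 35"
    using divisor_obstruction[of \<psi> 35 1 "- 8" "- 19" 0 5 1 "- 1" 43 3 0] by auto
  show "\<not> has_divisor \<psi> 14"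
    using divisor_obstruction[of \<psi> 14 2 "- 6" "- 16" 0 4 0 "- 1" 33 0 1] by auto
  show "\<not> has_divisor \<psi> 10"
    using divisor_obstruction[of \<psi> 10 3 "- 7" "- 16" 0 4 0 "- 1" 38 3 0] by auto
qed

section \<open>Galois action\<close>

lemma galois_homs:
  assumes "\<sigma> \<in> absolute_galois_group"
  shows "inj \<sigma>" "\<And>a b. \<sigma> (a + b) = \<sigma> a + \<sigma> b" "\<And>a b. \<sigma> (a * b) = \<sigma> a * \<sigma> b" "\<And>q. \<sigma> (to_ac q) = to_ac q"
  using assms by (auto simp: absolute_galois_group_def bij_is_inj)

lemma map_fract_rational:
  assumes "\<sigma> \<in> absolute_galois_group"
  shows "map_fract \<sigma> (Fract (map_poly to_ac p) 1) = Fract (map_poly to_ac p) 1"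
proof -
  note h = galois_homs[OF assms]
  have 01: "\<sigma> 0 = 0" "\<sigma> 1 = 1" using h(4)[of 0] h(4)[of 1] by simp_all
  have "map_poly \<sigma> (map_poly to_ac p) = map_poly to_ac p"
    by (rule poly_eqI) (simp add: coeff_map_poly 01 h(4))
  moreover have "map_poly \<sigma> 1 = 1" by (simp add: 01)
  ultimately show ?thesis by (simp add: map_fract_Fract[OF h(1-3)])
qed

lemma galois_fun_rational:
  assumes "\<sigma> \<in> absolute_galois_group"
  shows "galois_fun \<sigma> (to_pair (fn (map_poly to_ac a) (map_poly to_ac b))) =
    to_pair (fn (map_poly to_ac a) (map_poly to_ac b))"
  using map_fract_rational[OF assms] by (simp add: fn_Fn galois_fun_def)

lemma galois_fun_inverse:
  assumes "\<sigma> \<in> absolute_galois_group"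
  shows "galois_fun (inv_into UNIV \<sigma>) (galois_fun \<sigma> q) = q"
  using map_fract_map_fract_inv[OF assms] by (cases q) (simp add: galois_fun_def)

lemma inv_inv_galois: "\<sigma> \<in> absolute_galois_group \<Longrightarrow> inv_into UNIV (inv_into UNIV \<sigma>) = \<sigma>"
  by (simp add: inv_inv_eq absolute_galois_group_def)

lemma galois_place_inverse:
  assumes "\<sigma> \<in> absolute_galois_group"
  shows "galois_place (inv_into UNIV \<sigma>) (galois_place \<sigma> v) = v"
  unfolding galois_place_def inv_inv_galois[OF assms]
  by (rule ext) (simp add: galois_fun_inverse[OF assms])

text \<open>\<open>x - c\<close> and \<open>y - d\<close> have rational coefficients, so the
  transformed place is centred at the same point, and \<open>centred_unique\<close> applies.\<close>

lemma galois_place_rational: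
  assumes \<sigma>: "\<sigma> \<in> absolute_galois_group" and v: "centred v (to_ac c) (to_ac d)"
    and point: "on_curve (to_ac c) (to_ac d)"
  shows "galois_place \<sigma> (v \<circ> of_pair) = v \<circ> of_pair"
proof -
  let ?w = "galois_place \<sigma> (v \<circ> of_pair) \<circ> to_pair"
  have "(v \<circ> of_pair) \<circ> to_pair = v" by (simp add: fun_eq_iff)
  then have "v \<circ> of_pair \<in> places C70 (range const_fun)"
    using v by (simp only: places_iff centred_def)
  then have w: "place ?w"
    using galois_place_in_places[OF \<sigma>, of _ h70 f70] by (simp only: places_iff)
  have eq: "?w (fn (map_poly to_ac a) (map_poly to_ac b)) = v (fn (map_poly to_ac a) (map_poly to_ac b))" for a b
    by (simp add: galois_place_def galois_fun_rational[OF absolute_galois_group_inv[OF \<sigma>]])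
  have "xx - cst (to_ac c) = fn (map_poly to_ac [:- c, 1:]) (map_poly to_ac 0)"
    "yy - cst (to_ac d) = fn (map_poly to_ac [:- d:]) (map_poly to_ac 1)"
    by (simp_all add: fn_def map_poly_pCons cst.hom_minus cst.hom_one)
  then have "?w (xx - cst (to_ac c)) = v (xx - cst (to_ac c))" "?w (yy - cst (to_ac d)) = v (yy - cst (to_ac d))"
    by (simp_all only: eq)
  then have "centred ?w (to_ac c) (to_ac d)"
    using v w unfolding centred_def by (metis place_valued valued_field.vge_def)
  then have "?w = v" using centred_unique(1)[OF _ v point] by blast
  then show ?thesis by (auto simp: fun_eq_iff) (metis of_pair_to_pair(2))
qed

section \<open>The Galois action on divisors\<close>

lemma divisor_degree_diff: "divisor_degree (D - E) = divisor_degree D - divisor_degree E"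
  using divisor_degree_add[of D "- E"] by (simp add: divisor_degree_minus)

lemma divisor_degree_frag_of: "divisor_degree (frag_of v) = 1"
  by (simp add: divisor_degree_def)

lemma divisor_degree_galois: "divisor_degree (galois_divisor \<sigma> D) = divisor_degree D"
proof -
  have "Poly_Mapping.keys D \<subseteq> UNIV" by simp
  then show ?thesis
    by (induction D rule: frag_induction)
      (simp_all add: galois_divisor_def frag_extend_diff divisor_degree_diff divisor_degree_frag_of
        divisor_degree_def[of 0])
qed

lemma galois_divisor_add: "galois_divisor \<sigma> (D + E) = galois_divisor \<sigma> D + galois_divisor \<sigma> E"
  by (simp add: galois_divisor_def frag_extend_add)

lemma galois_divisor_inverse:
  assumes "\<sigma> \<in> absolute_galois_group"
  shows "galois_divisor (inv_into UNIV \<sigma>) (galois_divisor \<sigma> D) = D"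
proof -
  have "frag_of \<circ> galois_place (inv_into UNIV \<sigma>) \<circ> galois_place \<sigma> = frag_of"
    by (simp add: fun_eq_iff galois_place_inverse[OF assms])
  then show ?thesis
    unfolding galois_divisor_def frag_extend_compose by (simp flip: frag_expansion)
qed

lemma lookup_galois_divisor:
  assumes "\<sigma> \<in> absolute_galois_group"
  shows "Poly_Mapping.lookup (galois_divisor \<sigma> D) (galois_place \<sigma> v) = Poly_Mapping.lookup D v"
proof -
  have inj: "galois_place \<sigma> v = galois_place \<sigma> u \<longleftrightarrow> v = u" for u
    by (metis galois_place_inverse[OF assms])
  have "Poly_Mapping.keys D \<subseteq> UNIV" by simp
  then show ?thesis
    by (induction D rule: frag_induction)
      (simp_all add: galois_divisor_def frag_extend_diff lookup_minus lookup_frag_of inj)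
qed

lemma mem_div0_group:
  "D \<in> carrier (div0_group F k) \<longleftrightarrow> Poly_Mapping.keys D \<subseteq> places F k \<and> divisor_degree D = 0"
  by (simp add: div0_group_def)

lemma mult_div0_group: "D \<otimes>\<^bsub>div0_group F k\<^esub> E = D + E"
  by (simp add: div0_group_def)

abbreviation Div0 :: "((qbar quad_fun \<Rightarrow> int) \<Rightarrow>\<^sub>0 int) monoid" where
  "Div0 \<equiv> div0_group C70 (range const_fun)"

abbreviation Princ :: "((qbar quad_fun \<Rightarrow> int) \<Rightarrow>\<^sub>0 int) set" where
  "Princ \<equiv> principal_divisors C70 (range const_fun)"

text \<open>The image of the divisor of \<open>\<phi>\<close> is the divisor of
  \<open>\<sigma>(\<phi>)\<close>; orders are compared by pulling a place back along the inverse
  automorphism.\<close>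

lemma galois_divisor_principal:
  assumes \<sigma>: "\<sigma> \<in> absolute_galois_group" and D: "D \<in> Princ"
  shows "galois_divisor \<sigma> D \<in> Princ"
proof -
  let ?P = "places C70 (range const_fun)"
  define \<tau> where "\<tau> = inv_into UNIV \<sigma>"
  have \<tau>: "\<tau> \<in> absolute_galois_group" unfolding \<tau>_def by (rule absolute_galois_group_inv[OF \<sigma>])
  have \<tau>\<sigma>: "inv_into UNIV \<tau> = \<sigma>" unfolding \<tau>_def by (rule inv_inv_galois[OF \<sigma>])
  note \<sigma>\<tau> = galois_place_inverse[OF \<tau>, unfolded \<tau>\<sigma>]
  have DC: "Poly_Mapping.keys D \<subseteq> ?P" "divisor_degree D = 0"
    using D by (simp_all add: principal_divisors_def mem_div0_group)
  obtain \<phi> where \<phi>: "\<phi> \<in> carrier C70 - {\<zero>\<^bsub>C70\<^esub>}" "\<And>v. v \<in> ?P \<Longrightarrow> Poly_Mapping.lookup D v = v \<phi>"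
    using D unfolding principal_divisors_def by blast
  have "Poly_Mapping.keys (galois_divisor \<sigma> D) \<subseteq> ?P"
  proof -
    have "Poly_Mapping.keys (galois_divisor \<sigma> D) \<subseteq>
        (\<Union>x \<in> Poly_Mapping.keys D. Poly_Mapping.keys ((frag_of \<circ> galois_place \<sigma>) x))"
      unfolding galois_divisor_def by (rule keys_frag_extend)
    also have "\<dots> \<subseteq> ?P"
      using DC(1) galois_place_in_places[OF \<sigma>, of _ h70 f70] by auto
    finally show ?thesis .
  qed
  then have "galois_divisor \<sigma> D \<in> carrier Div0"
    using DC by (simp add: mem_div0_group divisor_degree_galois)
  moreover have "galois_fun \<sigma> \<phi> \<in> carrier C70 - {\<zero>\<^bsub>C70\<^esub>}"
  proof -
    have "map_fract \<tau> 0 = 0" using map_fract_rational[OF \<tau>, of 0] by (simp flip: Zero_fract_def)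
    then have "galois_fun \<tau> (0, 0) = (0, 0)" by (simp add: galois_fun_def)
    then have "galois_fun \<sigma> \<phi> = (0, 0) \<longrightarrow> \<phi> = (0, 0)" using galois_fun_inverse[OF \<sigma>, folded \<tau>_def] by metis
    then show ?thesis using \<phi>(1) by (simp add: geometric_function_field_def function_field_def)
  qed
  moreover have "Poly_Mapping.lookup (galois_divisor \<sigma> D) v = v (galois_fun \<sigma> \<phi>)" if "v \<in> ?P" for v
  proof -
    have "Poly_Mapping.lookup (galois_divisor \<sigma> D) v = Poly_Mapping.lookup D (galois_place \<tau> v)"
      using lookup_galois_divisor[OF \<sigma>, of D "galois_place \<tau> v"] by (simp add: \<sigma>\<tau>)
    also have "\<dots> = galois_place \<tau> v \<phi>" by (rule \<phi>(2)[OF galois_place_in_places[OF \<tau> that]])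
    finally show ?thesis by (simp add: galois_place_def \<tau>\<sigma>)
  qed
  ultimately show ?thesis unfolding principal_divisors_def by blast
qed


section \<open>The torsion point\<close>

definition torsion_divisor :: "(qbar quad_fun \<Rightarrow> int) \<Rightarrow>\<^sub>0 int" where
  "torsion_divisor = frag_of (vA \<circ> of_pair) - frag_of (vB \<circ> of_pair)"

lemma places_of_pair: "v \<circ> of_pair \<in> places C70 (range const_fun) \<longleftrightarrow> place v"
proof -
  have "(v \<circ> of_pair) \<circ> to_pair = v" by (simp add: fun_eq_iff)
  then show ?thesis by (simp only: places_iff)
qed

lemma torsion_divisor_carrier: "torsion_divisor \<in> carrier Div0"
proof -
  have "Poly_Mapping.keys torsion_divisor \<subseteq> {vA \<circ> of_pair, vB \<circ> of_pair}"
    unfolding torsion_divisor_def using keys_diff[of "frag_of (vA \<circ> of_pair)" "frag_of (vB \<circ> of_pair)"] by auto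
  then show ?thesis
    using place_vA place_vB places_of_pair
    by (auto simp: mem_div0_group torsion_divisor_def divisor_degree_diff divisor_degree_frag_of)
qed

lemma galois_torsion_divisor:
  assumes "\<sigma> \<in> absolute_galois_group"
  shows "galois_divisor \<sigma> torsion_divisor = torsion_divisor"
proof -
  have "galois_place \<sigma> (vA \<circ> of_pair) = vA \<circ> of_pair"
    using galois_place_rational[OF assms, of vA 2 17] centred_vA on_curve_A by simp
  moreover have "galois_place \<sigma> (vB \<circ> of_pair) = vB \<circ> of_pair"
    using galois_place_rational[OF assms, of vB 4 23] centred_vB on_curve_B by simp
  ultimately show ?thesis
    by (simp add: galois_divisor_def torsion_divisor_def frag_extend_diff)
qed

lemma pow_div0_group: "Poly_Mapping.lookup (D [^]\<^bsub>Div0\<^esub> (n :: nat)) v = int n * Poly_Mapping.lookup D v"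
proof (induction n)
  case 0
  then show ?case by (simp add: nat_pow_def) (simp add: div0_group_def)
next
  case (Suc n)
  have "D [^]\<^bsub>Div0\<^esub> Suc n = D [^]\<^bsub>Div0\<^esub> n + D"
    by (simp add: nat_pow_def mult_div0_group)
  then show ?case using Suc by (simp add: lookup_add algebra_simps)
qed

text \<open>Reduces principality to \<open>has_divisor\<close>: the quantifiers over places and
  functions pass to \<open>ff\<close> along the bijections, and powers stay among the divisors of
  degree zero.\<close>

lemma principal_pow_iff:
  "torsion_divisor [^]\<^bsub>Div0\<^esub> (n :: nat) \<in> Princ \<longleftrightarrow> (\<exists>\<psi>. has_divisor \<psi> (int n))"
proof -
  interpret comm_group Div0 by (rule comm_group_div0_group)
  have inj: "v \<circ> of_pair = w \<circ> of_pair \<longleftrightarrow> v = w" for v w :: "ff \<Rightarrow> int"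
    by (metis comp_assoc comp_id fun_eq_iff o_apply of_pair_to_pair(1))
  have val: "Poly_Mapping.lookup (torsion_divisor [^]\<^bsub>Div0\<^esub> n) (v \<circ> of_pair) =
      (if v = vA then int n else 0) - (if v = vB then int n else 0)" for v
    by (simp add: pow_div0_group torsion_divisor_def lookup_minus lookup_frag_of
        inj eq_commute[of _ v])
  have places: "(\<forall>v\<in>places C70 (range const_fun). P v) \<longleftrightarrow> (\<forall>v. place v \<longrightarrow> P (v \<circ> of_pair))" for P
  proof -
    have "(v \<circ> to_pair) \<circ> of_pair = v" for v :: "qbar quad_fun \<Rightarrow> int" by (simp add: fun_eq_iff)
    then show ?thesis by (metis places_iff places_of_pair)
  qed
  have ex: "(\<exists>\<phi>\<in>carrier C70 - {\<zero>\<^bsub>C70\<^esub>}. P \<phi>) \<longleftrightarrow> (\<exists>\<psi>. \<psi> \<noteq> 0 \<and> P (to_pair \<psi>))" for P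
  proof -
    have c: "carrier C70 = UNIV" "\<zero>\<^bsub>C70\<^esub> = to_pair 0"
      by (simp_all add: geometric_function_field_def function_field_def zero_ff_def)
    have "to_pair \<psi> = to_pair 0 \<longleftrightarrow> \<psi> = 0" for \<psi> by (metis of_pair_to_pair(1))
    moreover have "(\<exists>q. Q q) \<longleftrightarrow> (\<exists>\<psi>. Q (to_pair \<psi>))" for Q by (metis of_pair_to_pair(2))
    ultimately show ?thesis by (simp add: c Bex_def del: split_paired_Ex)
  qed
  have eq: "r = (v \<circ> of_pair) (to_pair \<psi>) \<longleftrightarrow> v \<psi> = r" for v :: "ff \<Rightarrow> int" and r \<psi>
    by auto
  show ?thesis
    unfolding principal_divisors_def mem_Collect_eq places ex val has_divisor_def eq
    using nat_pow_closed[OF torsion_divisor_carrier, of n] by simp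
qed

theorem theorem2p4:
  shows "\<exists>P \<in> jacobian_rational_points h70 f70. group.ord (jacobian h70 f70) P = 70"
proof -
  interpret Div0: comm_group Div0 by (rule comm_group_div0_group)
  have sub: "subgroup Princ Div0" by (rule subgroup_principal_divisors[OF field_C70])
  interpret N: normal Princ Div0 using sub by (simp add: Div0.normal_iff_subgroup)
  interpret J: comm_group "jacobian h70 f70"
    unfolding jacobian_def by (rule comm_group_pic0[OF field_C70])
  have J: "jacobian h70 f70 = Div0 Mod Princ" by (simp add: jacobian_def pic0_def)
  interpret q: group_hom Div0 "jacobian h70 f70" "\<lambda>D. Princ #>\<^bsub>Div0\<^esub> D"
    using N.r_coset_hom_Mod by unfold_locales (simp add: J)
  define P where "P = Princ #>\<^bsub>Div0\<^esub> torsion_divisor"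
  have P: "P \<in> carrier (jacobian h70 f70)"
    unfolding P_def by (rule q.hom_closed[OF torsion_divisor_carrier])
  have coset: "P = (\<lambda>E. E + torsion_divisor) ` Princ"
    unfolding P_def r_coset_def mult_div0_group by blast
  \<comment> \<open>The representative is fixed and \<open>Princ\<close> is mapped into itself,
    hence so is the coset.\<close>
  have image: "galois_divisor \<sigma> ` P \<subseteq> P" if \<sigma>: "\<sigma> \<in> absolute_galois_group" for \<sigma>
    unfolding coset using galois_divisor_principal[OF \<sigma>]
    by (auto simp: galois_divisor_add galois_torsion_divisor[OF \<sigma>])
  have "galois_divisor \<sigma> ` P = P" if \<sigma>: "\<sigma> \<in> absolute_galois_group" for \<sigma>
  proof
    \<comment> \<open>The reverse inclusion comes from \<open>image\<close> for the inverse
      automorphism.\<close>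
    show "P \<subseteq> galois_divisor \<sigma> ` P"
    proof
      fix D assume "D \<in> P"
      note \<tau> = absolute_galois_group_inv[OF \<sigma>]
      have "galois_divisor (inv_into UNIV \<sigma>) D \<in> P" using image[OF \<tau>] \<open>D \<in> P\<close> by blast
      moreover have "D = galois_divisor \<sigma> (galois_divisor (inv_into UNIV \<sigma>) D)"
        using galois_divisor_inverse[OF \<tau>] by (simp add: inv_inv_galois[OF \<sigma>])
      ultimately show "D \<in> galois_divisor \<sigma> ` P" by blast
    qed
  qed (rule image[OF \<sigma>])
  with P have "P \<in> jacobian_rational_points h70 f70"
    by (simp add: jacobian_rational_points_def)
  moreover have ord: "J.ord P dvd n \<longleftrightarrow> (\<exists>\<psi>. has_divisor \<psi> (int n))" for n
  proof -
    let ?D = "torsion_divisor [^]\<^bsub>Div0\<^esub> n"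
    have D: "?D \<in> carrier Div0" using torsion_divisor_carrier by simp
    have "P [^]\<^bsub>jacobian h70 f70\<^esub> n = Princ #>\<^bsub>Div0\<^esub> ?D"
      unfolding P_def using q.hom_nat_pow[OF torsion_divisor_carrier] by simp
    moreover have "\<one>\<^bsub>jacobian h70 f70\<^esub> = Princ" by (simp add: J)
    ultimately have "J.ord P dvd n \<longleftrightarrow> Princ #>\<^bsub>Div0\<^esub> ?D = Princ"
      using J.pow_eq_id[OF P, of n] by simp
    also have "\<dots> \<longleftrightarrow> ?D \<in> Princ"
      using Div0.coset_join1[OF _ D sub] Div0.coset_join2[OF D sub] by blast
    finally show ?thesis by (simp add: principal_pow_iff)
  qed
  have "J.ord P = 70"
  proof -
    \<comment> \<open>The numbers \<open>35\<close>, \<open>14\<close> and \<open>10\<close> are the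
      quotients of \<open>70\<close> by its primes, so every proper divisor of \<open>70\<close>
      divides one of them.\<close>
    have dvd: "J.ord P dvd 70" "\<not> J.ord P dvd 35" "\<not> J.ord P dvd 14" "\<not> J.ord P dvd 10"
      using ord[of 70] ord[of 35] ord[of 14] ord[of 10] has_divisor_70 not_has_divisor by simp_all
    obtain k where k: "70 = J.ord P * k" using dvd(1) by (rule dvdE)
    have "k = 1"
    proof (rule ccontr)
      assume "k \<noteq> 1"
      then obtain p where p: "prime p" "p dvd k" using prime_factor_nat by blast
      have "p dvd 2 * 35" using dvd_mult[OF p(2), of "J.ord P"] k by simp
      then have "p dvd 2 \<or> p dvd 5 * 7" using prime_dvd_multD[OF p(1)] by fastforce
      then consider "p dvd 2" | "p dvd 5" | "p dvd 7" using prime_dvd_multD[OF p(1)] by blast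
      then have p257: "p = 2 \<or> p = 5 \<or> p = 7"
        by cases (auto dest: primes_dvd_imp_eq[OF p(1), rotated])
      obtain l where "k = p * l" using p(2) by (rule dvdE)
      define e where "e = J.ord P * l"
      have "70 = p * e" using k \<open>k = p * l\<close> by (simp add: e_def ac_simps)
      with p257 have "e = 35 \<or> e = 14 \<or> e = 10" by auto
      then show False using dvd unfolding e_def by (metis dvd_triv_left)
    qed
    with k show ?thesis by simp
  qed
  ultimately show ?thesis by blast
qed

end
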